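(* Let $S\subset D^4$ be a properly embedded surface. If $S$ is contained in a shadow $X\subset D^4$, then $S$ is homotopically ribbon.
   Context: A properly embedded surface $S\subset D^4$ is homotopically ribbon if the inclusion $(S^3\setminus\partial S)\hookrightarrow(D^4\setminus S)$ induces an epimorphism $\pi_1(S^3\setminus\partial S)\to\pi_1(D^4\setminus S)$. A simple polyhedron $X$ is a 2-dimensional compact polyhedron in which every point has a neighborhood homeomorphic to one of five models: (1) the cone over the 1-skeleton of a tetrahedron; (2) $Y\times(-1,1)$, where $Y$ is the cone over three points; (3) an open disc; (4) a half-disc (boundary edge point); (5) $Y\times[0,1)$ at (cone point, $0$) (boundary vertex). Points of types (4) and (5) form the boundary $\partial X$. A shadow (for $D^4$) is a simple polyhedron $X\subset D^4$ such that: $X$ is properly embedded, i.e. $\partial X=X\cap S^3$; $X$ is locally flat, i.e. every $p\in X$ has a neighborhood $U$ in $D^4$ diffeomorphic to $B^3\times(-1,1)$ with $U\cap X$ contained in $B^3\times 0$ as one of the standard local models; $X$ collapses onto a point; and $D^4$ collapses onto $X$. *)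

theory Defs
  imports "HOL-Analysis.Analysis" "HOL-Algebra.Group"
begin

abbreviation D4 :: "(real^4) set" where
  "D4 \<equiv> cball 0 1"

abbreviation S3 :: "(real^4) set" where
  "S3 \<equiv> sphere 0 1"


section \<open>The fundamental group\<close>

definition homotopy_class :: "'a::topological_space set \<Rightarrow> (real \<Rightarrow> 'a) \<Rightarrow> (real \<Rightarrow> 'a) set" where
  "homotopy_class X g = {h. homotopic_paths X g h}"

definition loops_at :: "'a::topological_space set \<Rightarrow> 'a \<Rightarrow> (real \<Rightarrow> 'a) set" where
  "loops_at X a = {g. path g \<and> path_image g \<subseteq> X \<and> pathstart g = a \<and> pathfinish g = a}"

definition fundamental_group ::
    "'a::topological_space set \<Rightarrow> 'a \<Rightarrow> (real \<Rightarrow> 'a) set monoid" where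
  "fundamental_group X a =
     \<lparr>carrier = homotopy_class X ` loops_at X a,
      mult = (\<lambda>A B. \<Union>g\<in>A. \<Union>h\<in>B. homotopy_class X (g +++ h)),
      one = homotopy_class X (\<lambda>_. a)\<rparr>"

definition induced_map ::
    "'b::topological_space set \<Rightarrow> ('a \<Rightarrow> 'b) \<Rightarrow> (real \<Rightarrow> 'a) set \<Rightarrow> (real \<Rightarrow> 'b) set" where
  "induced_map Y f A = (\<Union>g\<in>A. homotopy_class Y (f \<circ> g))"


section \<open>Smooth maps and diffeomorphisms between subsets of Euclidean spaces\<close>

text \<open>Only meaningful for open \<open>U\<close>: all iterated directional derivatives up to order \<open>k\<close> exist
  and are continuous on \<open>U\<close>.\<close>

primrec Ck_on ::
    "nat \<Rightarrow> ('a::euclidean_space \<Rightarrow> 'b::euclidean_space) \<Rightarrow> 'a set \<Rightarrow> bool" where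
  "Ck_on 0 f U \<longleftrightarrow> continuous_on U f"
| "Ck_on (Suc k) f U \<longleftrightarrow>
     (\<forall>x\<in>U. f differentiable (at x)) \<and>
     (\<forall>v. Ck_on k (\<lambda>x. frechet_derivative f (at x) v) U)"

text \<open>A map on an arbitrary subset is smooth if it extends smoothly to an open neighbourhood of
  each point; on manifolds with boundary and on simplices this is the usual notion.\<close>

definition smooth_map_on :: "'a::euclidean_space set \<Rightarrow> ('a \<Rightarrow> 'b::euclidean_space) \<Rightarrow> bool" where
  "smooth_map_on A f \<longleftrightarrow>
     (\<forall>x\<in>A. \<exists>U g. open U \<and> x \<in> U \<and> (\<forall>k. Ck_on k g U) \<and> (\<forall>y\<in>U \<inter> A. g y = f y))"

definition diffeomorphism ::
    "'a::euclidean_space set \<Rightarrow> 'b::euclidean_space set \<Rightarrow> ('a \<Rightarrow> 'b) \<Rightarrow> ('b \<Rightarrow> 'a) \<Rightarrow> bool" where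
  "diffeomorphism A B f g \<longleftrightarrow> homeomorphism A B f g \<and> smooth_map_on A f \<and> smooth_map_on B g"


section \<open>Local models\<close>

text \<open>All five models are placed in the open unit ball of \<open>\<real>\<^sup>3\<close>, with the distinguished point at
  the origin.  The cone over a set surrounding the origin is the conic hull, cut off by the ball.
  The infinite cones over any two tetrahedra (or planar triangles) with the origin in their interior
  differ by a linear isomorphism, so the choice of vertices is immaterial, also for the smooth charts
  below.\<close>

definition B3 :: "(real^3) set" where
  "B3 = ball 0 1"

definition half_B3 :: "(real^3) set" where
  "half_B3 = B3 \<inter> {x. 0 \<le> x$3}"

definition tetrahedron_vertices :: "(real^3) set" where
  "tetrahedron_vertices = {vector [1,0,0], vector [0,1,0], vector [0,0,1], vector [-1,-1,-1]}"

definition vertex_model :: "(real^3) set" where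
  "vertex_model = B3 \<inter> conic hull
     (\<Union>v\<in>tetrahedron_vertices. \<Union>w\<in>tetrahedron_vertices. closed_segment v w)"

definition tripod :: "(real^3) set" where
  "tripod = conic hull {vector [1,0,0], vector [0,1,0], vector [-1,-1,0]}"

definition triple_line_model :: "(real^3) set" where
  "triple_line_model = B3 \<inter> {y + t *\<^sub>R vector [0,0,1] | y t. y \<in> tripod}"

definition disc_model :: "(real^3) set" where
  "disc_model = B3 \<inter> {x. x$1 = 0}"

definition half_disc_model :: "(real^3) set" where
  "half_disc_model = disc_model \<inter> half_B3"

definition boundary_vertex_model :: "(real^3) set" where
  "boundary_vertex_model = triple_line_model \<inter> half_B3"

definition interior_models :: "(real^3) set set" where
  "interior_models = {vertex_model, triple_line_model, disc_model}"

definition boundary_models :: "(real^3) set set" where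
  "boundary_models = {half_disc_model, boundary_vertex_model}"

definition locally_modelled :: "'a::topological_space set \<Rightarrow> 'a \<Rightarrow> (real^3) set \<Rightarrow> bool" where
  "locally_modelled X p M \<longleftrightarrow>
     (\<exists>N f g. openin (top_of_set X) N \<and> p \<in> N \<and> homeomorphism N M f g \<and> f p = 0)"


section \<open>Surfaces and homotopy ribbonness\<close>

text \<open>No smoothness is required of a surface: one that is carried by a simple polyhedron has corners
  wherever it crosses a triple line.\<close>

definition surface :: "'a::euclidean_space set \<Rightarrow> bool" where
  "surface S \<longleftrightarrow> compact S \<and>
     (\<forall>p\<in>S. locally_modelled S p disc_model \<or> locally_modelled S p half_disc_model)"

definition surface_boundary :: "'a::euclidean_space set \<Rightarrow> 'a set" where
  "surface_boundary S = {p \<in> S. locally_modelled S p half_disc_model}"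

definition properly_embedded_surface :: "(real^4) set \<Rightarrow> bool" where
  "properly_embedded_surface S \<longleftrightarrow> S \<subseteq> D4 \<and> surface S \<and> surface_boundary S = S \<inter> S3"

definition homotopically_ribbon :: "(real^4) set \<Rightarrow> bool" where
  "homotopically_ribbon S \<longleftrightarrow> properly_embedded_surface S \<and>
     (\<forall>a \<in> S3 - surface_boundary S.
        induced_map (D4 - S) id
          \<in> epi (fundamental_group (S3 - surface_boundary S) a) (fundamental_group (D4 - S) a))"


section \<open>Triangulations and collapses\<close>

text \<open>Simplicial complexes are taken in \<open>\<real>\<^sup>9\<close>, where every finite complex of dimension at most 4
  is realised.\<close>

definition smooth_triangulation ::
    "(real^9) set set \<Rightarrow> (real^9 \<Rightarrow> 'a::euclidean_space) \<Rightarrow> 'a set \<Rightarrow> bool" where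
  "smooth_triangulation K h A \<longleftrightarrow> simplicial_complex K \<and>
     (\<exists>g. homeomorphism (\<Union>K) A h g \<and> (\<forall>\<sigma>\<in>K. diffeomorphism \<sigma> (h ` \<sigma>) h g))"

definition elementary_collapse ::
    "'a::euclidean_space set set \<Rightarrow> 'a set set \<Rightarrow> bool" where
  "elementary_collapse K L \<longleftrightarrow>
     (\<exists>\<sigma>\<in>K. \<exists>\<tau>\<in>K. \<tau> facet_of \<sigma> \<and> (\<forall>\<rho>\<in>K. \<tau> face_of \<rho> \<longrightarrow> \<rho> = \<tau> \<or> \<rho> = \<sigma>) \<and> L = K - {\<sigma>, \<tau>})"

text \<open>Collapsing of polyhedra: a sequence of elementary simplicial collapses for some triangulation,
  compatible with the smooth structure of the ambient Euclidean space.\<close>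

definition collapses_onto :: "'a::euclidean_space set \<Rightarrow> 'a set \<Rightarrow> bool" where
  "collapses_onto A B \<longleftrightarrow>
     (\<exists>K L h. smooth_triangulation K h A \<and> elementary_collapse\<^sup>*\<^sup>* K L \<and> h ` (\<Union>L) = B)"


section \<open>Simple polyhedra and shadows\<close>

text \<open>A finite complex of dimension 2 already has a realisation in \<open>\<real>\<^sup>5\<close>.\<close>

definition compact_polyhedron_2d :: "'a::euclidean_space set \<Rightarrow> bool" where
  "compact_polyhedron_2d X \<longleftrightarrow>
     (\<exists>K :: (real^5) set set. simplicial_complex K \<and>
        (\<forall>\<sigma>\<in>K. aff_dim \<sigma> \<le> 2) \<and> (\<exists>\<sigma>\<in>K. aff_dim \<sigma> = 2) \<and> \<Union>K homeomorphic X)"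

definition simple_polyhedron :: "'a::euclidean_space set \<Rightarrow> bool" where
  "simple_polyhedron X \<longleftrightarrow> compact_polyhedron_2d X \<and>
     (\<forall>p\<in>X. \<exists>M \<in> interior_models \<union> boundary_models. locally_modelled X p M)"

definition polyhedron_boundary :: "'a::euclidean_space set \<Rightarrow> 'a set" where
  "polyhedron_boundary X = {p \<in> X. \<exists>M \<in> boundary_models. locally_modelled X p M}"

definition flat_chart :: "(real^4) set \<Rightarrow> real^4 \<Rightarrow> (real^3) set \<Rightarrow> (real^3) set \<Rightarrow> bool" where
  "flat_chart X p B M \<longleftrightarrow>
     (\<exists>U f g. openin (top_of_set D4) U \<and> p \<in> U \<and>
        diffeomorphism U (B \<times> {-1<..<1::real}) f g \<and> f p = (0, 0) \<and> f ` (U \<inter> X) = M \<times> {0})"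

text \<open>At a boundary point of \<open>X\<close>, which lies on the boundary of the 4-ball, the 3-ball of the
  product neighbourhood has to be read as a half-ball.\<close>

definition locally_flat :: "(real^4) set \<Rightarrow> bool" where
  "locally_flat X \<longleftrightarrow>
     (\<forall>p\<in>X. (\<exists>M \<in> interior_models. flat_chart X p B3 M) \<or>
            (\<exists>M \<in> boundary_models. flat_chart X p half_B3 M))"

definition shadow :: "(real^4) set \<Rightarrow> bool" where
  "shadow X \<longleftrightarrow> X \<subseteq> D4 \<and> simple_polyhedron X \<and>
     polyhedron_boundary X = X \<inter> S3 \<and> locally_flat X \<and>
     (\<exists>p. collapses_onto X {p}) \<and> collapses_onto D4 X"

end

theory Submission
  imports Defs
begin

text \<open>
  For a closed set \<open>S \<subseteq> X\<close>, let \<open>M\<close> be the complement in \<open>\<real>\<^sup>4\<close> of the preimage of \<open>S\<close> under the radial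
  retraction onto the ball.  It suffices that a path in \<open>M\<close> with both ends outside the ball is homotopic
  in \<open>M\<close> to a path outside the ball.  Send each point \<open>x\<close> outside the ball to the set of all paths in \<open>M\<close>
  from the base point to \<open>x\<close> that can be deformed out of the ball; this is a flat (locally constant)
  section of a local system over \<open>M\<close>, and the claim says that it extends to all of \<open>M\<close>.  Let a
  triangulation of the ball collapse onto \<open>X\<close>.  First extend over the complement of the 2-skeleton,
  one elementary collapse of \<open>\<sigma>\<close> through \<open>\<tau>\<close> at a time.  If \<open>dim \<sigma> = 4\<close>, the open simplex \<open>\<sigma>\<close> is reached
  through the 3-dimensional wall \<open>\<tau>\<close>.  If \<open>dim \<sigma> = 3\<close>, the section lives on both sides of the wall \<open>\<sigma>\<close>,
  and these sides are connected to each other around the free face \<open>\<tau>\<close>.  Finally, the 2-skeleton has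
  codimension 2, so it does not separate small balls and the section extends across it.\<close>

section \<open>Local systems of homotopy classes of paths\<close>

text \<open>Extending a section replaces the direct task of pushing a path off simplices: over a
  point outside the ball, membership in the value of the section means precisely a deformation off
  the ball, so a section on all of \<open>M\<close> can be evaluated along any path at once. The
  obstacle is monodromy. Opening a wall between two regions that already carry values demands that
  these values agree, and only the freeness of a face gives control over this. For the same reason
  the whole 2-skeleton stays removed until the end: near an interior point of a free face nothing is
  then removed except the collapsing simplex. Smoothness of the triangulation enters twice. It gives
  each 3-simplex charts in which it lies in a hyperplane, boundary points included, and it gives the
  cones over the 2-skeleton measure zero. Thickening the ball to an open subset of the whole space
  spares charts with boundary, and the region where the section starts becomes open.\<close>

text \<open>An element of the fibre over \<open>x\<close> is an arbitrary set of homotopy classes of paths, possibly empty;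
  this is what makes path-connectedness of the complements unnecessary.\<close>

definition path_fibre :: "'a::euclidean_space set \<Rightarrow> 'a \<Rightarrow> 'a \<Rightarrow> (real \<Rightarrow> 'a) set set" where
  "path_fibre M a x =
     {A. (\<forall>p\<in>A. path p \<and> path_image p \<subseteq> M \<and> pathstart p = a \<and> pathfinish p = x) \<and>
         (\<forall>p\<in>A. \<forall>q. homotopic_paths M p q \<longrightarrow> q \<in> A)}"

text \<open>The result is closed under homotopy again, so transport lands in the fibre over the
  endpoint and its laws become equations between sets.\<close>

definition transport :: "'a::euclidean_space set \<Rightarrow> (real \<Rightarrow> 'a) set \<Rightarrow> (real \<Rightarrow> 'a) \<Rightarrow> (real \<Rightarrow> 'a) set" where
  "transport M A g = {p. \<exists>q\<in>A. homotopic_paths M (q +++ g) p}"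

text \<open>The segments may leave \<open>U\<close>. The relation is applied to sets
  \<open>U\<close> inside a convex subset of \<open>M\<close>, where all paths with the same ends
  are homotopic.\<close>

definition flat_on :: "'a::euclidean_space set \<Rightarrow> ('a \<Rightarrow> (real \<Rightarrow> 'a) set) \<Rightarrow> 'a set \<Rightarrow> bool" where
  "flat_on M s U \<longleftrightarrow> (\<forall>x\<in>U. \<forall>y\<in>U. s y = transport M (s x) (linepath x y))"

text \<open>The centre \<open>p\<close> may lie outside \<open>U\<close>: flatness there is the
  criterion for the section to extend over \<open>p\<close>.\<close>

definition flat_at :: "'a::euclidean_space set \<Rightarrow> 'a set \<Rightarrow> ('a \<Rightarrow> (real \<Rightarrow> 'a) set) \<Rightarrow> 'a \<Rightarrow> bool" where
  "flat_at M U s p \<longleftrightarrow> (\<exists>e>0. ball p e \<subseteq> M \<and> flat_on M s (ball p e \<inter> U))"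

definition flat_section ::
    "'a::euclidean_space set \<Rightarrow> 'a \<Rightarrow> 'a set \<Rightarrow> ('a \<Rightarrow> (real \<Rightarrow> 'a) set) \<Rightarrow> bool" where
  "flat_section M a U s \<longleftrightarrow> (\<forall>x\<in>U. s x \<in> path_fibre M a x) \<and> (\<forall>p\<in>U. flat_at M U s p)"

section \<open>Functoriality of transport\<close>

lemma path_fibreD:
  assumes "A \<in> path_fibre M a x" "p \<in> A"
  shows "path p" "path_image p \<subseteq> M" "pathstart p = a" "pathfinish p = x"
  using assms by (auto simp: path_fibre_def)

lemma path_fibre_homotopic:
  "\<lbrakk>A \<in> path_fibre M a x; p \<in> A; homotopic_paths M p q\<rbrakk> \<Longrightarrow> q \<in> A"
  by (auto simp: path_fibre_def)

lemma transport_in_path_fibre: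
  assumes "A \<in> path_fibre M a x" "path g" "path_image g \<subseteq> M" "pathstart g = x" "pathfinish g = y"
  shows "transport M A g \<in> path_fibre M a y"
proof -
  have "path p \<and> path_image p \<subseteq> M \<and> pathstart p = a \<and> pathfinish p = y"
    if "q \<in> A" "homotopic_paths M (q +++ g) p" for p q
    using homotopic_paths_imp_path[OF that(2)] homotopic_paths_imp_subset[OF that(2)]
      homotopic_paths_imp_pathstart[OF that(2)] homotopic_paths_imp_pathfinish[OF that(2)]
      path_fibreD[OF assms(1) that(1)] assms by auto
  then show ?thesis
    unfolding path_fibre_def transport_def by (blast intro: homotopic_paths_trans)
qed

lemma transport_homotopic:
  assumes A: "A \<in> path_fibre M a x" and g: "homotopic_paths M g g'" "pathstart g = x"
  shows "transport M A g = transport M A g'"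
proof -
  have *: "transport M A g \<subseteq> transport M A g'" if g: "homotopic_paths M g g'" "pathstart g = x" for g g'
  proof
    fix p assume "p \<in> transport M A g"
    then obtain q where q: "q \<in> A" "homotopic_paths M (q +++ g) p"
      by (auto simp: transport_def)
    have "homotopic_paths M q q"
      using path_fibreD[OF A q(1)] by simp
    then have "homotopic_paths M (q +++ g) (q +++ g')"
      using g path_fibreD[OF A q(1)] by (intro homotopic_paths_join) auto
    then show "p \<in> transport M A g'"
      using q unfolding transport_def by (blast intro: homotopic_paths_trans homotopic_paths_sym)
  qed
  show ?thesis
    using * [OF g] * [of g' g] g homotopic_paths_imp_pathstart[OF g(1)]
    by (auto simp: homotopic_paths_sym)
qed

lemma transport_join:
  assumes A: "A \<in> path_fibre M a x"
    and g: "path g" "path_image g \<subseteq> M" "pathstart g = x" "pathfinish g = y"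
    and h: "path h" "path_image h \<subseteq> M" "pathstart h = y"
  shows "transport M (transport M A g) h = transport M A (g +++ h)"
proof -
  have assoc: "homotopic_paths M (q +++ (g +++ h)) ((q +++ g) +++ h)" if "q \<in> A" for q
    using path_fibreD[OF A that] g h by (intro homotopic_paths_assoc) auto
  have *: "homotopic_paths M ((q +++ g) +++ h) (p +++ h)" if "q \<in> A" "homotopic_paths M (q +++ g) p" for p q
    using that h g by (intro homotopic_paths_join) auto
  show ?thesis
  proof (intro equalityI subsetI)
    fix r assume "r \<in> transport M (transport M A g) h"
    then obtain q p where "q \<in> A" "homotopic_paths M (q +++ g) p" "homotopic_paths M (p +++ h) r"
      by (auto simp: transport_def)
    with assoc * show "r \<in> transport M A (g +++ h)"
      unfolding transport_def by (blast intro: homotopic_paths_trans)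
  next
    fix r assume "r \<in> transport M A (g +++ h)"
    then obtain q where q: "q \<in> A" "homotopic_paths M (q +++ (g +++ h)) r"
      by (auto simp: transport_def)
    have "homotopic_paths M (q +++ g) (q +++ g)"
      using path_fibreD[OF A q(1)] g by (simp add: path_image_join)
    then have "q +++ g \<in> transport M A g"
      using q unfolding transport_def by blast
    moreover have "homotopic_paths M ((q +++ g) +++ h) r"
      using assoc[OF q(1)] q(2) homotopic_paths_sym homotopic_paths_trans by blast
    ultimately show "r \<in> transport M (transport M A g) h"
      unfolding transport_def by blast
  qed
qed

lemma transport_refl:
  assumes A: "A \<in> path_fibre M a x"
  shows "transport M A (linepath x x) = A"
proof -
  have *: "homotopic_paths M (q +++ linepath x x) q" if "q \<in> A" for q
    using path_fibreD[OF A that] homotopic_paths_rid[of q M] by simp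
  show ?thesis
  proof (intro equalityI subsetI)
    fix p assume "p \<in> transport M A (linepath x x)"
    then obtain q where "q \<in> A" "homotopic_paths M (q +++ linepath x x) p"
      by (auto simp: transport_def)
    then show "p \<in> A"
      using * A path_fibre_homotopic homotopic_paths_sym homotopic_paths_trans by metis
  next
    fix p assume "p \<in> A" then show "p \<in> transport M A (linepath x x)"
      using * by (auto simp: transport_def)
  qed
qed

lemma homotopic_paths_in_convex:
  fixes C :: "'a::euclidean_space set"
  assumes "convex C" "C \<subseteq> M" "path g" "path_image g \<subseteq> C" "path h" "path_image h \<subseteq> C"
    "pathstart g = pathstart h" "pathfinish g = pathfinish h"
  shows "homotopic_paths M g h"
  using convex_imp_simply_connected[OF assms(1)] assms simply_connected_eq_homotopic_paths
    homotopic_paths_subset by (metis (no_types))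

lemma transport_linepath_linepath:
  assumes A: "A \<in> path_fibre M a x" and C: "convex C" "C \<subseteq> M" "x \<in> C" "y \<in> C" "z \<in> C"
  shows "transport M (transport M A (linepath x y)) (linepath y z) = transport M A (linepath x z)"
proof -
  have sub: "closed_segment x y \<subseteq> C" "closed_segment y z \<subseteq> C" "closed_segment x z \<subseteq> C"
    using C by (simp_all add: closed_segment_subset)
  then have "homotopic_paths M (linepath x y +++ linepath y z) (linepath x z)"
    using C by (intro homotopic_paths_in_convex[OF C(1,2)]) (auto simp: path_image_join)
  then show ?thesis
    using A sub C by (subst transport_join[OF A]) (auto intro!: transport_homotopic[OF A])
qed

lemma transport_linepath_in_path_fibre:
  assumes "A \<in> path_fibre M a x" "convex C" "C \<subseteq> M" "x \<in> C" "y \<in> C"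
  shows "transport M A (linepath x y) \<in> path_fibre M a y"
  using assms closed_segment_subset[of x C y]
  by (intro transport_in_path_fibre[OF assms(1)]) auto

section \<open>Flat sections: gluing, extension to limit points, evaluation along paths\<close>

lemma flat_onD: "\<lbrakk>flat_on M s U; x \<in> U; y \<in> U\<rbrakk> \<Longrightarrow> s y = transport M (s x) (linepath x y)"
  unfolding flat_on_def by blast

lemma flat_on_subset: "\<lbrakk>flat_on M s V; U \<subseteq> V\<rbrakk> \<Longrightarrow> flat_on M s U"
  by (auto simp: flat_on_def)

lemma flat_at_subset: "\<lbrakk>flat_at M V s p; U \<subseteq> V\<rbrakk> \<Longrightarrow> flat_at M U s p"
  unfolding flat_at_def by (meson Int_mono flat_on_subset order_refl)

lemma flat_section_subset: "\<lbrakk>flat_section M a V s; U \<subseteq> V\<rbrakk> \<Longrightarrow> flat_section M a U s"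
  unfolding flat_section_def by (meson flat_at_subset subsetD)

lemma flat_section_fibre: "\<lbrakk>flat_section M a U s; x \<in> U\<rbrakk> \<Longrightarrow> s x \<in> path_fibre M a x"
  by (auto simp: flat_section_def)

text \<open>Over the convex set \<open>C\<close> all fibres are identified by transport to the one
  point \<open>x\<close>. Each piece becomes constant, and the single match between \<open>x\<close>
  and \<open>y\<close> equates the two constants; the pieces may be disjoint.\<close>

lemma flat_on_Un:
  assumes s: "\<And>x. x \<in> U \<union> V \<Longrightarrow> s x \<in> path_fibre M a x"
    and C: "convex C" "C \<subseteq> M" "U \<subseteq> C" "V \<subseteq> C"
    and fl: "flat_on M s U" "flat_on M s V"
    and xy: "x \<in> U" "y \<in> V" "s y = transport M (s x) (linepath x y)"
  shows "flat_on M s (U \<union> V)"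
proof -
  define T where "T z = transport M (s z) (linepath z x)" for z
  note tt = transport_linepath_linepath[OF s C(1,2)]
  have x: "x \<in> C" and y: "y \<in> C" using xy C by auto
  have U: "T z = s x" if "z \<in> U" for z
    using flat_onD[OF fl(1) that xy(1)] by (simp add: T_def)
  have V: "T z = s x" if "z \<in> V" for z
  proof -
    have "s z = transport M (s y) (linepath y z)"
      using flat_onD[OF fl(2) xy(2) that] .
    then have "s z = transport M (s x) (linepath x z)"
      using xy tt[of x y z] x y C that by auto
    then show ?thesis
      using tt[of x z x] xy C that x transport_refl[OF s[of x]] by (auto simp: T_def)
  qed
  show ?thesis
    unfolding flat_on_def
  proof (intro ballI)
    fix z w assume zw: "z \<in> U \<union> V" "w \<in> U \<union> V"
    then have "z \<in> C" "w \<in> C" using C by auto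
    have "s w = transport M (T w) (linepath x w)"
      using tt[of w x w] zw \<open>w \<in> C\<close> x transport_refl[OF s[OF zw(2)]] by (simp add: T_def)
    also have "T w = T z" using zw U V by (metis UnE)
    also have "transport M (T z) (linepath x w) = transport M (s z) (linepath z w)"
      using tt[of z x w] zw \<open>w \<in> C\<close> \<open>z \<in> C\<close> x by (simp add: T_def)
    finally show "s w = transport M (s z) (linepath z w)" .
  qed
qed

text \<open>Transport inside \<open>C\<close> to a fixed point of \<open>W\<close> turns the section
  into a locally constant function on \<open>W\<close>, which connectedness makes constant. Paths
  inside \<open>W\<close> never occur.\<close>

lemma flat_on_connected:
  assumes s: "flat_section M a U s" and W: "connected W" "W \<subseteq> U" "W \<subseteq> C" and C: "convex C" "C \<subseteq> M"
  shows "flat_on M s W"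
proof (cases "W = {}")
  case False
  then obtain c where c: "c \<in> W" by auto
  note fib = flat_section_fibre[OF s]
  note tt = transport_linepath_linepath[OF fib C]
  define T where "T z = transport M (s z) (linepath z c)" for z
  have "\<exists>N. openin (top_of_set W) N \<and> p \<in> N \<and> (\<forall>x\<in>N. T x = T p)" if p: "p \<in> W" for p
  proof -
    obtain e where e: "e > 0" "ball p e \<subseteq> M" "flat_on M s (ball p e \<inter> U)"
      using s p W unfolding flat_section_def flat_at_def by blast
    have "T x = T p" if "x \<in> ball p e \<inter> W" for x
    proof -
      have "s p = transport M (s x) (linepath x p)"
        using flat_onD[OF e(3), of x p] e(1) p that W by auto
      then show ?thesis
        using tt[of x p c] c that p W by (auto simp: T_def)
    qed
    moreover have "openin (top_of_set W) (ball p e \<inter> W)"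
      by (metis Int_commute open_ball openin_open_Int)
    moreover have "p \<in> ball p e \<inter> W"
      using e(1) p by simp
    ultimately show ?thesis by blast
  qed
  then have "T constant_on W"
    by (rule locally_constant_imp_constant[OF W(1)])
  then have const: "T x = T y" if "x \<in> W" "y \<in> W" for x y
    using that unfolding constant_on_def by metis
  show ?thesis
    unfolding flat_on_def
  proof (intro ballI)
    fix x y assume xy: "x \<in> W" "y \<in> W"
    then have C': "x \<in> C" "y \<in> C" "c \<in> C" "x \<in> U" "y \<in> U" using W c by auto
    have "s y = transport M (T y) (linepath c y)"
      unfolding T_def using tt[of y c y] C' transport_refl[OF fib[of y]] by metis
    also have "T y = T x" by (rule const[OF xy(2,1)])
    also have "transport M (T x) (linepath c y) = transport M (s x) (linepath x y)"
      unfolding T_def using tt[of x c y] C' by metis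
    finally show "s y = transport M (s x) (linepath x y)" .
  qed
qed (auto simp: flat_on_def)

text \<open>The value at a limit point is imported from any nearby point of \<open>U\<close>;
  flatness at the limit point makes the choice immaterial.\<close>

lemma flat_section_extend:
  assumes s: "flat_section M a U s" and W: "U \<subseteq> W" "W \<subseteq> closure U"
    and fl: "\<And>p. p \<in> W \<Longrightarrow> flat_at M U s p"
  obtains s' where "flat_section M a W s'" "\<And>x. x \<in> U \<Longrightarrow> s' x = s x"
proof -
  note fib = flat_section_fibre[OF s]
  obtain e where e: "e p > 0" "ball p (e p) \<subseteq> M" "flat_on M s (ball p (e p) \<inter> U)" if "p \<in> W" for p
    using fl unfolding flat_at_def by metis
  \<comment> \<open>Choosing \<open>p\<close> itself whenever \<open>p\<close> lies in
    \<open>U\<close> makes the extension agree with \<open>s\<close> there.\<close>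
  have "\<exists>y. y \<in> ball p (e p) \<inter> U \<and> (p \<in> U \<longrightarrow> y = p)" if p: "p \<in> W" for p
  proof (cases "p \<in> U")
    case False
    have "ball p (e p) \<inter> U \<noteq> {}"
      using e(1)[OF p] W p by (meson centre_in_ball disjoint_iff open_Int_closure_eq_empty open_ball subset_iff)
    with False show ?thesis by blast
  qed (use e(1)[OF p] in auto)
  then obtain y where y: "y p \<in> ball p (e p)" "y p \<in> U" "p \<in> U \<Longrightarrow> y p = p" if "p \<in> W" for p
    by (metis IntD1 IntD2)
  define s' where "s' p = transport M (s (y p)) (linepath (y p) p)" for p
  have eq: "s' p = s p" if "p \<in> U" for p
    using y(3)[of p] that W transport_refl[OF fib[OF that]] by (simp add: s'_def subset_iff)
  have s': "s' p = transport M (s x) (linepath x p)" if "p \<in> W" "x \<in> ball p (e p) \<inter> U" for p x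
  proof -
    have "s (y p) = transport M (s x) (linepath x (y p))"
      using flat_onD[OF e(3)[OF that(1)], of x "y p"] that y[OF that(1)] by auto
    then show ?thesis
      using transport_linepath_linepath[OF fib convex_ball e(2)[OF that(1)], of x "y p" p]
        that y[OF that(1)] e(1)[OF that(1)] by (auto simp: s'_def)
  qed
  \<comment> \<open>The value at \<open>q\<close> was imported inside the ball around
    \<open>q\<close>. Density provides a point \<open>z\<close> of \<open>U\<close> in both balls,
    and \<open>z\<close> compares that value with the one imported from \<open>x\<close> inside the
    ball around \<open>p\<close>.\<close>
  have nb: "s' q = transport M (s x) (linepath x q)"
    if that: "p \<in> W" "q \<in> W" "q \<in> ball p (e p)" "x \<in> ball p (e p) \<inter> U" for p q x
  proof -
    have qW: "q \<in> closure U" using that(2) W by blast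
    have "open (ball p (e p) \<inter> ball q (e q))" "q \<in> ball p (e p) \<inter> ball q (e q)"
      using that e(1)[of q] by auto
    then obtain z where z: "z \<in> ball p (e p)" "z \<in> ball q (e q)" "z \<in> U"
      using qW open_Int_closure_eq_empty[of "ball p (e p) \<inter> ball q (e q)" U] by blast
    have "s z = transport M (s x) (linepath x z)"
      using flat_onD[OF e(3)[OF that(1)], of x z] that z by auto
    then show ?thesis
      using transport_linepath_linepath[OF fib convex_ball e(2)[OF that(1)], of x z q]
        that z s'[of q z] by auto
  qed
  have fib': "s' p \<in> path_fibre M a p" if "p \<in> W" for p
    unfolding s'_def
    using y[OF that] e[OF that] by (intro transport_linepath_in_path_fibre[OF fib convex_ball e(2)[OF that]]) auto
  have "flat_at M W s' p" if p: "p \<in> W" for p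
    unfolding flat_at_def
  proof (intro exI conjI)
    show "flat_on M s' (ball p (e p) \<inter> W)"
      unfolding flat_on_def
    proof (intro ballI)
      fix x z assume xz: "x \<in> ball p (e p) \<inter> W" "z \<in> ball p (e p) \<inter> W"
      have yp: "y p \<in> ball p (e p)" "y p \<in> U" using y(1,2)[OF p] .
      have "transport M (s' x) (linepath x z) = transport M (transport M (s (y p)) (linepath (y p) x)) (linepath x z)"
        using nb[of p x "y p"] xz p yp by auto
      also have "\<dots> = transport M (s (y p)) (linepath (y p) z)"
        using transport_linepath_linepath[OF fib convex_ball e(2)[OF p], of "y p" x z] xz yp by auto
      also have "\<dots> = s' z"
        using nb[of p z "y p"] xz p yp by auto
      finally show "s' z = transport M (s' x) (linepath x z)" by simp
    qed
  qed (use e[OF p] in auto)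
  with fib' eq that show ?thesis
    unfolding flat_section_def by blast
qed

text \<open>Local flatness passes the identity for initial subpaths between close parameters, and
  connectedness of the unit interval carries it from 0 to 1.\<close>

lemma flat_section_along_path:
  assumes s: "flat_section M a M s" and g: "path g" "path_image g \<subseteq> M"
  shows "s (pathfinish g) = transport M (s (pathstart g)) g"
proof -
  note fib = flat_section_fibre[OF s]
  define P where "P t \<longleftrightarrow> s (g t) = transport M (s (g 0)) (subpath 0 t g)" for t
  have gM: "g t \<in> M" if "t \<in> {0..1}" for t
    using g that by (auto simp: path_image_def)
  have step: "\<exists>T. openin (top_of_set {0..1::real}) T \<and> t \<in> T \<and> (\<forall>x\<in>T. \<forall>y\<in>T. P x \<longrightarrow> P y)"
    if t: "t \<in> {0..1}" for t
  proof -
    obtain e where e: "e > 0" "ball (g t) e \<subseteq> M" "flat_on M s (ball (g t) e \<inter> M)"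
      using s gM[OF t] by (auto simp: flat_section_def flat_at_def)
    obtain d where d: "d > 0" "\<And>u. \<lbrakk>u \<in> {0..1}; dist u t < d\<rbrakk> \<Longrightarrow> dist (g u) (g t) < e"
      using g(1) t e(1) unfolding path_def continuous_on_iff by metis
    define T where "T = {0..1} \<inter> ball t d"
    have "P y" if x: "x \<in> T" and y: "y \<in> T" and P: "P x" for x y
    proof -
      have xy: "x \<in> {0..1}" "y \<in> {0..1}" using x y by (auto simp: T_def)
      have img: "path_image (subpath x y g) \<subseteq> ball (g t) e"
      proof -
        have "closed_segment x y \<subseteq> T"
          using x y unfolding T_def by (intro closed_segment_subset convex_Int) auto
        then have "g ` closed_segment x y \<subseteq> ball (g t) e"
          using d(2) unfolding T_def by (auto simp: dist_commute subset_iff)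
        then show ?thesis by (simp add: path_image_subpath_gen)
      qed
      have pxy: "path (subpath x y g)" "path (subpath 0 x g)" "path (subpath 0 y g)"
        using g xy by auto
      have i0: "path_image (subpath 0 x g) \<subseteq> M" "path_image (subpath x y g) \<subseteq> M"
        using g xy path_image_subpath_subset[of 0 x g] path_image_subpath_subset[of x y g] by auto
      have end_mem: "g x \<in> ball (g t) e" "g y \<in> ball (g t) e"
        using img pathstart_in_path_image[of "subpath x y g"] pathfinish_in_path_image[of "subpath x y g"] by auto
      have "s (g y) = transport M (s (g x)) (linepath (g x) (g y))"
        using flat_onD[OF e(3), of "g x" "g y"] end_mem gM xy by auto
      also have "\<dots> = transport M (s (g x)) (subpath x y g)"
      proof (rule transport_homotopic[OF fib])
        show "homotopic_paths M (linepath (g x) (g y)) (subpath x y g)"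
          using end_mem pxy img closed_segment_subset[OF end_mem convex_ball]
          by (intro homotopic_paths_in_convex[OF convex_ball e(2)]) auto
      qed (use gM xy in auto)
      also have "\<dots> = transport M (transport M (s (g 0)) (subpath 0 x g)) (subpath x y g)"
        using P by (simp add: P_def)
      also have "\<dots> = transport M (s (g 0)) (subpath 0 x g +++ subpath x y g)"
        using i0 pxy gM by (intro transport_join[OF fib]) auto
      also have "\<dots> = transport M (s (g 0)) (subpath 0 y g)"
        using g xy gM i0 by (intro transport_homotopic[OF fib] homotopic_join_subpaths) auto
      finally show ?thesis by (simp add: P_def)
    qed
    moreover have "openin (top_of_set {0..1}) T" "t \<in> T"
      using d(1) t by (simp_all add: T_def openin_open_Int)
    ultimately show ?thesis by blast
  qed
  have "P 0"
    using transport_refl[OF fib[OF gM[of 0]]] by (simp add: P_def linepath_refl subpath_def)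
  then have "P 1"
    using connected_induction_simple[of "{0..1::real}" 0 1 P] step by (simp add: connected_Icc)
  then show ?thesis
    by (simp add: P_def pathstart_def pathfinish_def)
qed

text \<open>The local system is trivial over a simply connected set: a value at one point is spread
  by transport along arbitrary paths in \<open>N\<close>, whose choice does not matter.\<close>

lemma simply_connected_flat_section:
  assumes N: "open N" "simply_connected N" "N \<subseteq> M" "x0 \<in> N" and A: "A \<in> path_fibre M a x0"
  obtains s where "flat_section M a N s" "s x0 = A"
proof -
  have "path_connected N"
    using N simply_connected_imp_path_connected by blast
  then have "\<exists>p. path p \<and> path_image p \<subseteq> N \<and> pathstart p = x0 \<and> pathfinish p = x" if "x \<in> N" for x
    using N that by (auto simp: path_connected_def)
  then obtain p where p: "path (p x)" "path_image (p x) \<subseteq> N" "pathstart (p x) = x0" "pathfinish (p x) = x"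
    if "x \<in> N" for x by metis
  have hom: "homotopic_paths M q r"
    if "path q" "path_image q \<subseteq> N" "path r" "path_image r \<subseteq> N" "pathstart q = pathstart r" "pathfinish q = pathfinish r" for q r
    using N that homotopic_paths_subset unfolding simply_connected_eq_homotopic_paths by (metis (no_types))
  define s where "s x = transport M A (p x)" for x
  have fib: "s x \<in> path_fibre M a x" if "x \<in> N" for x
    unfolding s_def using p[OF that] N by (intro transport_in_path_fibre[OF A]) auto
  have "flat_at M N s x" if x: "x \<in> N" for x
  proof -
    obtain e where e: "e > 0" "ball x e \<subseteq> N"
      using N x openE by blast
    have "s z = transport M (s y) (linepath y z)" if y: "y \<in> ball x e" and z: "z \<in> ball x e" for y z
    proof -
      have yz: "closed_segment y z \<subseteq> N" "y \<in> N" "z \<in> N"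
        using e y z closed_segment_subset[OF y z] by auto
      have "transport M (s y) (linepath y z) = transport M A (p y +++ linepath y z)"
        unfolding s_def using p[OF yz(2)] yz N by (intro transport_join[OF A]) auto
      also have "\<dots> = s z"
        unfolding s_def using p[OF yz(2)] p[OF yz(3)] yz
        by (intro transport_homotopic[OF A] hom) (auto simp: path_image_join)
      finally show ?thesis by simp
    qed
    then show ?thesis
      using e N unfolding flat_at_def flat_on_def by (intro exI[of _ e]) auto
  qed
  moreover have "s x0 = A"
  proof -
    have "homotopic_paths M (p x0) (linepath x0 x0)"
      using p[OF N(4)] N(4) by (intro hom) auto
    then have "s x0 = transport M A (linepath x0 x0)"
      unfolding s_def using p[OF N(4)] by (intro transport_homotopic[OF A]) auto
    then show ?thesis using transport_refl[OF A] by simp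
  qed
  ultimately show ?thesis
    using that fib unfolding flat_section_def by blast
qed

text \<open>With \<open>U\<close> the part of \<open>M\<close> outside the ball, this is the section
  to be extended. Appending a segment within \<open>U\<close> preserves deformability into
  \<open>U\<close>, and the reverse segment undoes the appending.\<close>

lemma flat_section_homotopic_into:
  assumes U: "open U" "U \<subseteq> M"
  shows "flat_section M a U
    (\<lambda>x. {p. \<exists>q. path q \<and> path_image q \<subseteq> U \<and> pathstart q = a \<and> pathfinish q = x \<and> homotopic_paths M q p})"
    (is "flat_section M a U ?s")
proof -
  define s where "s = ?s"
  have fib: "s x \<in> path_fibre M a x" for x
  proof -
    have "path p \<and> path_image p \<subseteq> M \<and> pathstart p = pathstart q \<and> pathfinish p = pathfinish q"
      if "homotopic_paths M q p" for p q
      using homotopic_paths_imp_pathstart[OF that] homotopic_paths_imp_pathfinish[OF that]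
        homotopic_paths_imp_path[OF that] homotopic_paths_imp_subset[OF that] by auto
    then show ?thesis
      unfolding path_fibre_def s_def by (auto intro: homotopic_paths_trans)
  qed
  have sub: "s y \<supseteq> transport M (s x) (linepath x y)" if xy: "closed_segment x y \<subseteq> U" for x y
  proof
    fix p assume "p \<in> transport M (s x) (linepath x y)"
    then obtain q r where q: "path q" "path_image q \<subseteq> U" "pathstart q = a" "pathfinish q = x"
      and qr: "homotopic_paths M q r" and rp: "homotopic_paths M (r +++ linepath x y) p"
      by (auto simp: transport_def s_def)
    have "homotopic_paths M (linepath x y) (linepath x y)"
      using xy U by auto
    then have "homotopic_paths M (q +++ linepath x y) (r +++ linepath x y)"
      using q qr by (intro homotopic_paths_join) auto
    then show "p \<in> s y"
      unfolding s_def
      using q xy rp by (intro CollectI exI[of _ "q +++ linepath x y"])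
        (auto simp: s_def path_image_join intro: homotopic_paths_trans)
  qed
  have "flat_at M U s x" if x: "x \<in> U" for x
  proof -
    obtain e where e: "e > 0" "ball x e \<subseteq> U"
      using U x openE by blast
    have "s z = transport M (s y) (linepath y z)" if y: "y \<in> ball x e" and z: "z \<in> ball x e" for y z
    proof
      have yz: "closed_segment y z \<subseteq> U" "closed_segment z y \<subseteq> U"
        using e closed_segment_subset[OF y z] by (auto simp: closed_segment_commute)
      show "s z \<supseteq> transport M (s y) (linepath y z)" by (rule sub[OF yz(1)])
      have "s z = transport M (transport M (s z) (linepath z y)) (linepath y z)"
        using transport_linepath_linepath[OF fib convex_ball, where x = z and y = y and z = z] e U y z transport_refl[OF fib] by auto
      also have "\<dots> \<subseteq> transport M (s y) (linepath y z)"
        using sub[OF yz(2)] unfolding transport_def by blast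
      finally show "s z \<subseteq> transport M (s y) (linepath y z)" .
    qed
    then show ?thesis
      using e U unfolding flat_at_def flat_on_def by (intro exI[of _ e]) auto
  qed
  then have "flat_section M a U s" using fib unfolding flat_section_def by blast
  then show ?thesis by (simp add: s_def)
qed

text \<open>\<open>A\<close> and \<open>B\<close> are the two sides of a wall. The jump of the
  section between them is the same throughout \<open>V\<close>, because all comparisons take place
  in the convex set \<open>C\<close>; flatness at the one wall point \<open>q\<close> says that it
  vanishes.\<close>

lemma flat_at_two_sided:
  assumes s: "flat_section M a U s" and V: "open V" "V \<subseteq> C" "convex C" "C \<subseteq> M"
    and AB: "connected A" "connected B" "V \<inter> U = A \<union> B"
    and q: "flat_at M U s q" "q \<in> V" "q \<in> closure A" "q \<in> closure B" and p: "p \<in> V"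
  shows "flat_at M U s p"
proof -
  obtain e where e: "e > 0" "flat_on M s (ball q e \<inter> U)"
    using q(1) by (auto simp: flat_at_def)
  define N where "N = ball q e \<inter> V"
  have N: "open N" "q \<in> N"
    using e(1) V(1) q(2) by (auto simp: N_def)
  obtain x y where xy: "x \<in> A \<inter> N" "y \<in> B \<inter> N"
    using N q(3,4) open_Int_closure_eq_empty[OF N(1)] by blast
  have sub: "A \<subseteq> U" "B \<subseteq> U" "A \<subseteq> C" "B \<subseteq> C" using AB V by auto
  have "s y = transport M (s x) (linepath x y)"
    using flat_onD[OF e(2), of x y] xy sub by (auto simp: N_def)
  then have "flat_on M s (A \<union> B)"
    using xy sub V flat_section_fibre[OF s]
    by (intro flat_on_Un[of A B s M a C x y] flat_on_connected[OF s AB(1)] flat_on_connected[OF s AB(2)]) auto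
  moreover obtain d where "d > 0" "ball p d \<subseteq> V"
    using V(1) p openE by blast
  ultimately show ?thesis
    using V AB unfolding flat_at_def by (intro exI[of _ d]) (auto elim!: flat_on_subset)
qed

text \<open>In a two-sided neighbourhood the section is flat at all wall points or at none, so
  flatness at one point spreads over a connected wall.\<close>

lemma flat_at_wall:
  assumes s: "flat_section M a U s" and W: "connected W" "q \<in> W" "flat_at M U s q" "p \<in> W"
    and two_sided: "\<And>u. u \<in> W \<Longrightarrow> \<exists>V C A B. open V \<and> u \<in> V \<and> V \<subseteq> C \<and> convex C \<and> C \<subseteq> M \<and>
          connected A \<and> connected B \<and> V \<inter> U = A \<union> B \<and> V \<inter> W \<subseteq> closure A \<inter> closure B"
  shows "flat_at M U s p"
proof (rule connected_induction_simple[of W q p])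
  fix u assume u: "u \<in> W"
  from two_sided[OF u] obtain V C A B where V: "open V" "u \<in> V" "V \<subseteq> C" "convex C" "C \<subseteq> M"
      "connected A" "connected B" "V \<inter> U = A \<union> B" "V \<inter> W \<subseteq> closure A \<inter> closure B" by blast
  have "flat_at M U s y" if "x \<in> W \<inter> V" "y \<in> W \<inter> V" "flat_at M U s x" for x y
    using that V(9) by (intro flat_at_two_sided[OF s V(1,3-8), of x y]) auto
  then show "\<exists>T. openin (top_of_set W) T \<and> u \<in> T \<and> (\<forall>x\<in>T. \<forall>y\<in>T. flat_at M U s x \<longrightarrow> flat_at M U s y)"
    using u V(1,2) by (intro exI[of _ "W \<inter> V"] conjI openin_open_Int ballI impI) blast+
qed (use W in auto)

section \<open>General position: sets with negligible cones do not separate open convex sets\<close>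

lemma path_connected_diff_negligible_cones:
  fixes B Z :: "'a::euclidean_space set"
  assumes B: "open B" "convex B"
    and neg: "\<And>x. negligible {x + t *\<^sub>R (z - x) | t z. z \<in> Z}"
  shows "path_connected (B - Z)"
  unfolding path_connected_def
proof (intro ballI)
  fix x y assume xy: "x \<in> B - Z" "y \<in> B - Z"
  let ?C = "\<lambda>x. {x + t *\<^sub>R (z - x) | t z. z \<in> Z}"
  have "negligible (?C x \<union> ?C y)"
    using neg by (intro negligible_Un) auto
  moreover have "\<not> negligible B"
    using B xy open_not_negligible by blast
  \<comment> \<open>A point \<open>r\<close> off both cones can be seen from \<open>x\<close> and
    from \<open>y\<close> along segments that miss \<open>Z\<close>.\<close>
  ultimately obtain r where r: "r \<in> B" "r \<notin> ?C x" "r \<notin> ?C y"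
    using negligible_subset[of "?C x \<union> ?C y" B] by blast
  have seg: "closed_segment w r \<subseteq> B - Z" if w: "w \<in> B - Z" "r \<notin> ?C w" for w
  proof
    fix z assume z: "z \<in> closed_segment w r"
    then have "z \<in> B" using w r(1) B by (meson DiffD1 closed_segment_subset subsetD)
    moreover have "z \<notin> Z"
    proof
      assume zZ: "z \<in> Z"
      obtain u where u: "z = (1 - u) *\<^sub>R w + u *\<^sub>R r"
        using z by (auto simp: in_segment)
      have "u \<noteq> 0" using u zZ w by auto
      moreover have "z - w = u *\<^sub>R (r - w)" using u by (simp add: algebra_simps)
      ultimately have "r = w + (1/u) *\<^sub>R (z - w)" by simp
      then show False using w(2) zZ by blast
    qed
    ultimately show "z \<in> B - Z" by simp
  qed
  have "path_image (linepath x r +++ linepath r y) \<subseteq> B - Z"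
    using seg[OF xy(1) r(2)] seg[OF xy(2) r(3)] by (simp add: path_image_join closed_segment_commute)
  then show "\<exists>g. path g \<and> path_image g \<subseteq> B - Z \<and> pathstart g = x \<and> pathfinish g = y"
    by (intro exI[of _ "linepath x r +++ linepath r y"]) auto
qed

text \<open>Measure zero of a differentiable image rests on comparing dimensions of types, so a
  bound on the affine dimension is turned into a parametrisation by a space of small dimension. An
  isometry embeds the direction space of \<open>T\<close>, and \<open>k\<close> is a linear left
  inverse of it.\<close>

lemma affine_parametrisation:
  fixes T :: "'b::euclidean_space set"
  assumes "aff_dim T \<le> int (DIM('c::euclidean_space))"
  obtains c and k :: "'c::euclidean_space \<Rightarrow> 'b" where "linear k" "T \<subseteq> range (\<lambda>u. c + k u)"
proof (cases "T = {}")
  case True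
  then show ?thesis using that[of "\<lambda>_. 0" 0] by (simp add: linear_zero)
next
  case False
  then obtain c where c: "c \<in> T" by auto
  define S where "S = span ((\<lambda>x. - c + x) ` T)"
  have "dim S \<le> dim (UNIV :: 'c set)"
    using aff_dim_eq_dim[of c T] c assms by (simp add: S_def hull_inc)
  then obtain f :: "'b \<Rightarrow> 'c" where f: "linear f" "\<And>x. x \<in> S \<Longrightarrow> norm (f x) = norm x"
    using isometry_subset_subspace[of S "UNIV :: 'c set"] by (auto simp: S_def)
  have inj: "inj_on f S"
    unfolding linear_injective_on_subspace_0[OF f(1) subspace_span[of "(\<lambda>x. - c + x) ` T", folded S_def]]
    using f(2) by (metis norm_eq_zero)
  then obtain k where k: "linear k" "\<And>x. x \<in> S \<Longrightarrow> k (f x) = x"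
    using linear_exists_left_inverse_on[OF f(1) _ inj] by (auto simp: S_def)
  have "x = c + k (f (- c + x))" if "x \<in> T" for x
    using k(2)[of "- c + x"] that by (simp add: S_def span_base)
  then show ?thesis using that[OF k(1), of c] by blast
qed

lemma smooth_map_on_imp_differentiable_on:
  assumes "smooth_map_on A f"
  shows "f differentiable_on A"
  unfolding differentiable_on_def
proof
  fix x assume x: "x \<in> A"
  then obtain U g where U: "open U" "x \<in> U" "\<forall>k. Ck_on k g U" "\<And>y. y \<in> U \<inter> A \<Longrightarrow> g y = f y"
    using assms unfolding smooth_map_on_def by metis
  have "g differentiable at x"
    using spec[OF U(3), of 1] U(2) by simp
  then have g: "g differentiable (at x within A)"
    by (rule differentiable_at_withinI)
  obtain d where d: "d > 0" "ball x d \<subseteq> U" using U openE by blast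
  show "f differentiable (at x within A)"
    using g d(1) x by (rule differentiable_transform_within) (use d U in \<open>auto simp: dist_commute subset_iff\<close>)
qed

text \<open>The factor \<open>t\<close> and two parameters for \<open>T\<close> describe the cone,
  so it is a differentiable image of a subset of a 3-dimensional space, while the target has
  dimension at least 4.\<close>

lemma negligible_cone_smooth_image:
  fixes f :: "'b::euclidean_space \<Rightarrow> 'a::euclidean_space"
  assumes "smooth_map_on T f" "aff_dim T \<le> 2" "DIM('a) > 3"
  shows "negligible {x + t *\<^sub>R (z - x) | t z. z \<in> f ` T}"
proof -
  obtain c and k :: "real^2 \<Rightarrow> 'b" where k: "linear k" "T \<subseteq> range (\<lambda>u. c + k u)"
    by (rule affine_parametrisation[of T, where ?'c="real^2"]) (use assms(2) in auto)
  define D where "D = (UNIV :: real set) \<times> {u. c + k u \<in> T}"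
  define F where "F = (\<lambda>(t,u). x + t *\<^sub>R (f (c + k u) - x))"
  have "(\<lambda>p. f (c + k (snd p))) differentiable_on D"
  proof -
    have "(\<lambda>p :: real \<times> (real^2). c + k (snd p)) differentiable_on D"
      by (intro derivative_intros differentiable_on_compose[of k, unfolded o_def]
           linear_imp_differentiable_on linear_compose[OF linear_snd k(1), unfolded o_def])
    moreover have "f differentiable_on ((\<lambda>p. c + k (snd p)) ` D)"
      by (rule differentiable_on_subset[OF smooth_map_on_imp_differentiable_on[OF assms(1)]])
        (auto simp: D_def)
    ultimately show ?thesis by (rule differentiable_on_compose)
  qed
  then have "F differentiable_on D"
    unfolding F_def case_prod_unfold
    by (intro derivative_intros) (auto intro: linear_imp_differentiable_on linear_fst)
  then have "negligible (F ` D)"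
    by (intro negligible_differentiable_image_lowdim) (use assms(3) in auto)
  moreover have "{x + t *\<^sub>R (z - x) | t z. z \<in> f ` T} \<subseteq> F ` D"
  proof clarify
    fix t u assume u: "u \<in> T"
    then obtain v where "u = c + k v" using k(2) by auto
    then show "x + t *\<^sub>R (f u - x) \<in> F ` D"
      using u by (intro image_eqI[of _ _ "(t, v)"]) (auto simp: F_def D_def)
  qed
  ultimately show ?thesis by (rule negligible_subset)
qed

lemma flat_section_extend_negligible_cones:
  fixes M Z :: "'a::euclidean_space set"
  assumes s: "flat_section M a (M - Z) s" and M: "open M"
    and neg: "\<And>x. negligible {x + t *\<^sub>R (z - x) | t z. z \<in> Z}"
  obtains s' where "flat_section M a M s'" "\<And>x. x \<in> M - Z \<Longrightarrow> s' x = s x"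
proof -
  \<comment> \<open>At \<open>t = 1\<close> the cone passes through \<open>Z\<close> itself,
    whatever its apex.\<close>
  have "negligible Z"
    by (rule negligible_subset[OF neg[of undefined]]) (force intro: exI[of _ 1])
  then have "closure (- Z) = UNIV"
    using negligible_subset[OF _ interior_subset] open_not_negligible[OF open_interior, of Z]
    by (metis closure_complement compl_bot_eq)
  then have "M \<subseteq> closure (M - Z)"
    using open_Int_closure_subset[OF M, of "- Z"] by (simp add: Diff_eq)
  moreover have "flat_at M (M - Z) s p" if p: "p \<in> M" for p
  proof -
    obtain e where e: "e > 0" "ball p e \<subseteq> M" using M p openE by blast
    have "flat_on M s (ball p e - Z)"
      using path_connected_diff_negligible_cones[OF open_ball convex_ball neg, of p e] e(2)
      by (intro flat_on_connected[OF s, of _ "ball p e"] path_connected_imp_connected) auto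
    then show ?thesis
      using e unfolding flat_at_def by (intro exI[of _ e]) (auto elim!: flat_on_subset)
  qed
  ultimately show ?thesis
    using flat_section_extend[OF s, of M] that by blast
qed

section \<open>Charts around codimension one simplices\<close>

text \<open>\<open>G\<close> inverts \<open>H\<close> only on a convex set that may have
  \<open>u\<close> on its boundary. One-sided derivatives along segments from \<open>u\<close> into
  \<open>\<sigma>\<close> still give the identity on the directions \<open>x - u\<close>, and
  linearity extends it to their span.\<close>

lemma convex_directional_derivative_inverse:
  assumes \<sigma>: "convex \<sigma>" "u \<in> \<sigma>" "w \<in> span ((\<lambda>x. - u + x) ` \<sigma>)"
    and H: "(H has_derivative H') (at u)" and G: "(G has_derivative G') (at (H u))"
    and U: "open U" "u \<in> U" "\<And>x. x \<in> \<sigma> \<inter> U \<Longrightarrow> G (H x) = x"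
  shows "G' (H' w) = w"
proof -
  have lin: "linear (\<lambda>w. G' (H' w))"
    using has_derivative_linear[OF H] has_derivative_linear[OF G] linear_compose[of H' G'] by (simp add: o_def)
  have "G' (H' (- u + x)) = - u + x" if x: "x \<in> \<sigma>" for x
  proof -
    define c where "c t = u + t *\<^sub>R (x - u)" for t :: real
    have dc: "(c has_derivative (\<lambda>t. t *\<^sub>R (x - u))) (at 0 within {0..1})"
      unfolding c_def by (auto intro!: derivative_eq_intros)
    have c0: "c 0 = u" by (simp add: c_def)
    have GHc: "((\<lambda>t. G (H (c t))) has_derivative (\<lambda>t. G' (H' (t *\<^sub>R (x - u))))) (at 0 within {0..1})"
      using has_derivative_compose[OF has_derivative_compose[OF dc, of H H'], of G G'] H G c0 by simp
    obtain d where d: "d > 0" "\<And>t. \<lbrakk>t \<in> {0..1}; dist t 0 < d\<rbrakk> \<Longrightarrow> c t \<in> U"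
    proof -
      have "continuous_on UNIV c" unfolding c_def by (intro continuous_intros)
      then have "open (c -` U)" using U(1) by (simp add: open_vimage)
      moreover have "0 \<in> c -` U" using U(2) c0 by simp
      ultimately obtain d where "d > 0" "ball 0 d \<subseteq> c -` U" using openE by blast
      then show ?thesis by (intro that[of d]) (auto simp: subset_iff)
    qed
    have cs: "c t \<in> \<sigma>" if "t \<in> {0..1}" for t
    proof -
      have "c t = (1 - t) *\<^sub>R u + t *\<^sub>R x" by (simp add: c_def algebra_simps)
      then show ?thesis using convexD_alt[OF \<sigma>(1,2) x, of t] that by simp
    qed
    have "(c has_derivative (\<lambda>t. G' (H' (t *\<^sub>R (x - u))))) (at 0 within {0..1})"
      by (rule has_derivative_transform_within[OF GHc d(1)]) (use d U(3) cs in auto)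
    then have "(c has_vector_derivative G' (H' (x - u))) (at 0 within {0..1})"
      using linear_cmul[OF lin] by (simp add: has_vector_derivative_def)
    moreover have "(c has_vector_derivative (x - u)) (at 0 within {0..1})"
      using dc by (simp add: has_vector_derivative_def)
    ultimately have "G' (H' (x - u)) = x - u"
      by (intro vector_derivative_unique_within_closed_interval[of 0 1 0 c]) auto
    then show ?thesis by (simp add: algebra_simps)
  qed
  moreover have "linear (\<lambda>w. w :: 'a)" by (rule linear_ident)
  ultimately show ?thesis
    using linear_eq_on_span[OF lin, of "\<lambda>w. w" "(\<lambda>x. - u + x) ` \<sigma>" w] \<sigma>(3) by auto
qed

lemma Ck_on_Suc_0D:
  assumes "Ck_on (Suc 0) H U"
  shows "\<And>x. x \<in> U \<Longrightarrow> (H has_derivative frechet_derivative H (at x)) (at x)"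
    "\<And>v. continuous_on U (\<lambda>x. frechet_derivative H (at x) v)"
  using assms frechet_derivative_works by auto

text \<open>Near \<open>u\<close> the smooth extension \<open>H\<close> of \<open>h\<close> lives on
  the whole affine hull, also past the boundary of \<open>\<sigma>\<close>. Adding a transversal
  vector \<open>m\<close> in the remaining coordinate gives a map between spaces of equal dimension.
  The smooth inverse \<open>g\<close> makes the derivative of \<open>H\<close> injective on tangent
  directions, so the inverse function theorem applies.\<close>

lemma smooth_embedding_hyperplane_chart:
  fixes \<sigma> :: "'b::euclidean_space set" and h :: "'b \<Rightarrow> 'a::euclidean_space"
  assumes h: "diffeomorphism \<sigma> (h ` \<sigma>) h g" and \<sigma>: "convex \<sigma>" "aff_dim \<sigma> = int DIM('a) - 1"
    and u: "u \<in> \<sigma>" and W: "open W" "h u \<in> W" and n: "n \<in> (Basis :: 'a set)"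
  obtains \<psi> \<psi>' :: "'a \<Rightarrow> 'a" and f :: "'a \<Rightarrow> 'b" and e V where
    "e > 0" "open V" "V \<subseteq> W" "homeomorphism (ball 0 e) V \<psi> \<psi>'" "\<psi> 0 = h u" "linear f"
    "f ` {x. x \<bullet> n = 0} = span ((\<lambda>x. - u + x) ` \<sigma>)" "\<And>x. x \<bullet> n = 0 \<Longrightarrow> norm (f x) = norm x"
    "\<And>x. x \<in> ball 0 e \<Longrightarrow> \<psi> x \<in> h ` \<sigma> \<longleftrightarrow> x \<bullet> n = 0 \<and> u + f x \<in> \<sigma>"
proof -
  define P where "P = {x::'a. x \<bullet> n = 0}"
  define S where "S = span ((\<lambda>x. - u + x) ` \<sigma>)"
  have hom: "homeomorphism \<sigma> (h ` \<sigma>) h g" and sm: "smooth_map_on \<sigma> h" "smooth_map_on (h ` \<sigma>) g"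
    using h by (auto simp: diffeomorphism_def)
  obtain U H where U: "open U" "u \<in> U" "Ck_on (Suc 0) H U" and Hh: "\<And>y. y \<in> U \<inter> \<sigma> \<Longrightarrow> H y = h y"
    using sm(1) u unfolding smooth_map_on_def by metis
  obtain U2 G where U2: "open U2" "h u \<in> U2" "Ck_on (Suc 0) G U2" and Gg: "\<And>y. y \<in> U2 \<inter> h ` \<sigma> \<Longrightarrow> G y = g y"
    using sm(2) u unfolding smooth_map_on_def by (metis imageI)
  note dH = Ck_on_Suc_0D[OF U(3)]
  note dG = Ck_on_Suc_0D[OF U2(3)]
  have Hu: "H u = h u" using Hh U u by auto
  define H' where "H' x = frechet_derivative H (at x)" for x
  have linH: "linear (H' x)" if "x \<in> U" for x
    using has_derivative_linear[OF dH(1)[OF that]] by (simp add: H'_def)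
  have contH: "continuous_on U H"
    using dH(1) by (meson continuous_at_imp_continuous_on has_derivative_continuous)
  define G' where "G' = frechet_derivative G (at (h u))"
  have G': "(G has_derivative G') (at (H u))" "linear G'"
    using dG(1)[OF U2(2)] has_derivative_linear by (auto simp: G'_def Hu)
  have GH: "G' (H' u w) = w" if "w \<in> S" for w
  proof (rule convex_directional_derivative_inverse[of \<sigma> u w H "H' u" G G' "U \<inter> H -` U2"])
    show "convex \<sigma>" "u \<in> \<sigma>" "w \<in> span ((\<lambda>x. - u + x) ` \<sigma>)" "(G has_derivative G') (at (H u))"
      using \<sigma>(1) u that G'(1) by (auto simp: S_def)
    show "(H has_derivative H' u) (at u)" using dH(1)[OF U(2)] by (simp add: H'_def)
    show "open (U \<inter> H -` U2)" using contH U(1) U2(1) by (rule continuous_open_preimage)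
    show "u \<in> U \<inter> H -` U2" using U U2 Hu by auto
    show "G (H x) = x" if "x \<in> \<sigma> \<inter> (U \<inter> H -` U2)" for x
      using that Gg Hh[of x] homeomorphism_apply1[OF hom, of x] by auto
  qed
  have dimS: "int (dim S) = int DIM('a) - 1"
    using aff_dim_eq_dim[of u \<sigma>] u \<sigma>(2) by (simp add: S_def hull_inc)
  have n0: "n \<noteq> 0" "n \<bullet> n = 1" using n by auto
  have subP: "subspace P" using subspace_hyperplane[of n] by (simp add: P_def inner_commute)
  have dimP: "dim P = DIM('a) - 1"
    using dim_hyperplane[of n] n0 by (simp add: P_def inner_commute)
  have "dim P = dim S" using dimS dimP DIM_positive[where 'a='a] by linarith
  then obtain f0 g0 where f0: "linear f0" "f0 ` P = S" "\<And>x. x \<in> P \<Longrightarrow> norm (f0 x) = norm x"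
    using isometries_subspaces[OF subP, of S] by (metis S_def subspace_span)
  \<comment> \<open>Projecting along \<open>n\<close> first gives \<open>f\<close> values in
    \<open>S\<close> everywhere, so the coordinate along \<open>n\<close> is left free for the
    transversal direction.\<close>
  define pr where "pr x = x - (x \<bullet> n) *\<^sub>R n" for x
  have pr: "linear pr" "\<And>x. pr x \<in> P" "\<And>x. x \<in> P \<Longrightarrow> pr x = x"
    unfolding pr_def P_def using n0
    by (auto intro!: linearI simp: algebra_simps inner_simps)
  define f where "f x = f0 (pr x)" for x
  have f: "linear f" "f ` P = S" "\<And>x. x \<in> P \<Longrightarrow> norm (f x) = norm x" "\<And>x. f x \<in> S"
    using linear_compose[OF pr(1) f0(1)] f0 pr by (auto simp: f_def[abs_def] o_def image_iff)
  have "dim (H' u ` S) < DIM('a)"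
    using dim_image_le[OF linH[OF U(2)], of S] dimS by linarith
  then obtain m where m: "m \<notin> H' u ` S"
    by (metis UNIV_eq_I dim_UNIV less_irrefl)
  define \<phi> where "\<phi> x = H (u + f x) + (x \<bullet> n) *\<^sub>R m" for x
  define \<phi>' where "\<phi>' x = Blinfun (\<lambda>y. H' (u + f x) (f y) + (y \<bullet> n) *\<^sub>R m)" for x
  define D where "D = {x. u + f x \<in> U}"
  have contf: "continuous_on UNIV f" using f(1) by (simp add: linear_continuous_on linear_conv_bounded_linear)
  have D: "open D" "0 \<in> D"
  proof -
    have "D = (\<lambda>x. u + f x) -` U" by (auto simp: D_def)
    moreover have "continuous_on UNIV (\<lambda>x. u + f x)"
      using contf by (intro continuous_intros)
    ultimately show "open D" using U(1) by (simp add: open_vimage)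
    show "0 \<in> D" using U(2) linear_0[OF f(1)] by (simp add: D_def)
  qed
  have lin\<phi>: "linear (\<lambda>y. H' (u + f x) (f y) + (y \<bullet> n) *\<^sub>R m)" if "x \<in> D" for x
    using linear_compose[OF f(1) linH[of "u + f x"]] that
    by (intro linear_compose_add) (auto simp: D_def o_def intro!: linearI simp: inner_simps algebra_simps)
  have app: "blinfun_apply (\<phi>' x) = (\<lambda>y. H' (u + f x) (f y) + (y \<bullet> n) *\<^sub>R m)" if "x \<in> D" for x
    unfolding \<phi>'_def using lin\<phi>[OF that] by (intro bounded_linear_Blinfun_apply) (simp add: linear_conv_bounded_linear)
  have der: "(\<phi> has_derivative blinfun_apply (\<phi>' x)) (at x)" if "x \<in> D" for x
  proof -
    have "((\<lambda>x. u + f x) has_derivative f) (at x)"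
      using linear_imp_has_derivative[OF f(1), of "at x"] by (auto intro!: derivative_eq_intros)
    moreover have "(H has_derivative H' (u + f x)) (at (u + f x))"
      using dH(1)[of "u + f x"] that by (simp add: D_def H'_def)
    ultimately have "((\<lambda>x. H (u + f x)) has_derivative (\<lambda>y. H' (u + f x) (f y))) (at x)"
      by (rule has_derivative_compose)
    then show ?thesis
      unfolding app[OF that] \<phi>_def by (auto intro!: derivative_eq_intros)
  qed
  have cont: "continuous_on D \<phi>'"
  proof (rule continuous_on_blinfun_componentwise)
    fix i :: 'a assume "i \<in> Basis"
    have "continuous_on D (\<lambda>x. H' (u + f x) (f i) + (i \<bullet> n) *\<^sub>R m)"
    proof (intro continuous_intros)
      have "continuous_on D (\<lambda>x. u + f x)"
        using contf by (intro continuous_intros) (auto intro: continuous_on_subset)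
      moreover have "(\<lambda>x. u + f x) ` D \<subseteq> U" by (auto simp: D_def)
      ultimately show "continuous_on D (\<lambda>x. H' (u + f x) (f i))"
        unfolding H'_def by (rule continuous_on_compose2[OF dH(2)])
    qed
    then show "continuous_on D (\<lambda>x. blinfun_apply (\<phi>' x) i)"
      using app by (simp cong: continuous_on_cong)
  qed
  have "inj (\<lambda>y. H' (u + f 0) (f y) + (y \<bullet> n) *\<^sub>R m)"
  proof (subst linear_injective_0[OF lin\<phi>[OF D(2)]], intro allI impI)
    fix y assume y: "H' (u + f 0) (f y) + (y \<bullet> n) *\<^sub>R m = 0"
    have y': "H' u (f y) = - ((y \<bullet> n) *\<^sub>R m)"
      using y linear_0[OF f(1)] by (simp add: eq_neg_iff_add_eq_0)
    have "y \<bullet> n = 0"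
    proof (rule ccontr)
      assume ne: "y \<bullet> n \<noteq> 0"
      have "H' u ((- 1 / (y \<bullet> n)) *\<^sub>R f y) = (- 1 / (y \<bullet> n)) *\<^sub>R H' u (f y)"
        by (rule linear_cmul[OF linH[OF U(2)]])
      also have "\<dots> = m" using y' ne by simp
      finally have "H' u ((- 1 / (y \<bullet> n)) *\<^sub>R f y) = m" .
      moreover have "(- 1 / (y \<bullet> n)) *\<^sub>R f y \<in> S"
        using f(4) unfolding S_def by (rule span_mul)
      ultimately show False using m by blast
    qed
    then have "y \<in> P" "H' u (f y) = 0" using y' by (auto simp: P_def)
    moreover from this have "f y = 0" using GH[OF f(4)[of y]] linear_0[OF G'(2)] by simp
    ultimately show "y = 0" using f(3)[of y] by simp
  qed
  then obtain k where k: "linear k" "k \<circ> (\<lambda>y. H' (u + f 0) (f y) + (y \<bullet> n) *\<^sub>R m) = id"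
    using linear_injective_left_inverse[OF lin\<phi>[OF D(2)]] by blast
  have "Blinfun k o\<^sub>L \<phi>' 0 = id_blinfun"
  proof (rule blinfun_eqI)
    fix y show "blinfun_apply (Blinfun k o\<^sub>L \<phi>' 0) y = blinfun_apply id_blinfun y"
      using k fun_cong[OF k(2), of y, unfolded o_def] app[OF D(2)]
      by (simp add: bounded_linear_Blinfun_apply linear_conv_bounded_linear)
  qed
  then obtain U1 V1 g1 where U1: "open U1" "U1 \<subseteq> D" "0 \<in> U1" "open V1" "homeomorphism U1 V1 \<phi> g1"
    using inverse_function_theorem[OF D(1) der cont D(2)] by metis
  have \<phi>0: "\<phi> 0 = h u" using linear_0[OF f(1)] Hu by (simp add: \<phi>_def)
  obtain \<delta> where \<delta>: "\<delta> > 0" "ball 0 \<delta> \<subseteq> U1" using U1 openE by blast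
  \<comment> \<open>Continuity of \<open>g\<close> keeps distant parts of \<open>\<sigma>\<close>
    away from the chart: a point of its image within \<open>\<gamma>\<close> of \<open>h u\<close>
    has its parameter within \<open>\<delta>\<close> of \<open>u\<close>, where
    \<open>\<phi>\<close> is injective.\<close>
  have "continuous_on (h ` \<sigma>) g" using hom by (simp add: homeomorphism_def)
  then obtain \<gamma> where \<gamma>: "\<gamma> > 0" "\<And>y. \<lbrakk>y \<in> h ` \<sigma>; dist y (h u) < \<gamma>\<rbrakk> \<Longrightarrow> dist (g y) (g (h u)) < \<delta>"
    using u \<delta>(1) unfolding continuous_on_iff by (metis imageI)
  have cont\<phi>: "continuous_on U1 \<phi>" using U1 by (simp add: homeomorphism_def)
  have "open (U1 \<inter> \<phi> -` (W \<inter> ball (h u) \<gamma>))"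
    using cont\<phi> U1(1) W(1) by (intro continuous_open_preimage) auto
  moreover have "0 \<in> U1 \<inter> \<phi> -` (W \<inter> ball (h u) \<gamma>)"
    using U1 W \<phi>0 \<gamma> by auto
  ultimately obtain e where e: "e > 0" "ball 0 e \<subseteq> U1 \<inter> \<phi> -` (W \<inter> ball (h u) \<gamma>)"
    using openE by blast
  define V where "V = \<phi> ` ball 0 e"
  have homV: "homeomorphism (ball 0 e) V \<phi> g1"
    unfolding V_def using e by (intro homeomorphism_of_subsets[OF U1(5)]) auto
  have "openin (top_of_set V1) V"
    unfolding V_def using homeomorphism_imp_open_map[OF U1(5), of "ball 0 e"] e
    by (simp add: open_openin_trans open_subset U1(1))
  then have "open V" using U1(4) openin_open_trans by (metis openin_open_eq)
  moreover have "V \<subseteq> W" using e by (auto simp: V_def)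
  moreover have "\<phi> x \<in> h ` \<sigma> \<longleftrightarrow> x \<bullet> n = 0 \<and> u + f x \<in> \<sigma>" if x: "x \<in> ball 0 e" for x
  proof
    assume "x \<bullet> n = 0 \<and> u + f x \<in> \<sigma>"
    moreover have "u + f x \<in> U" using x e U1 by (auto simp: D_def)
    ultimately show "\<phi> x \<in> h ` \<sigma>" using Hh[of "u + f x"] by (auto simp: \<phi>_def)
  next
    assume "\<phi> x \<in> h ` \<sigma>"
    then obtain v where v: "v \<in> \<sigma>" "\<phi> x = h v" by auto
    have "dist (h v) (h u) < \<gamma>" using v x e by (auto simp: dist_commute)
    then have dv: "dist v u < \<delta>"
      using \<gamma>(2)[of "h v"] v u homeomorphism_apply1[OF hom] by auto
    have "- u + v \<in> S" unfolding S_def using v by (auto intro: span_base)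
    then obtain y where y: "y \<in> P" "f y = - u + v" using f(2) by (metis imageE)
    have "norm y = dist v u" using f(3)[OF y(1)] y(2) by (simp add: dist_norm)
    then have yU: "y \<in> U1" using \<delta> dv by auto
    have vy: "u + f y = v" using y by simp
    have "\<phi> y = \<phi> x"
      using Hh[of v] yU U1 v y vy by (auto simp: \<phi>_def D_def P_def)
    then have "y = x"
      using yU x e homeomorphism_apply1[OF U1(5)] by (metis IntD1 subsetD)
    then show "x \<bullet> n = 0 \<and> u + f x \<in> \<sigma>" using y vy v by (auto simp: P_def)
  qed
  ultimately show ?thesis
    using that[OF e(1) _ _ homV \<phi>0 f(1)] f(2,3) by (auto simp: P_def S_def)
qed

text \<open>In the chart the image of \<open>\<sigma>\<close> lies in a hyperplane: \<open>A\<close>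
  and \<open>B\<close> are the images of the two open half-balls, and \<open>E\<close> is the part
  of the hyperplane that \<open>\<sigma>\<close> leaves uncovered. At a relative boundary point
  \<open>E\<close> is the passage from one side to the other.\<close>

lemma smooth_simplex_two_sided:
  fixes \<sigma> :: "'b::euclidean_space set" and h :: "'b \<Rightarrow> 'a::euclidean_space"
  assumes h: "diffeomorphism \<sigma> (h ` \<sigma>) h g" and \<sigma>: "convex \<sigma>" "aff_dim \<sigma> = int DIM('a) - 1"
    and u: "u \<in> \<sigma>" and W: "open W" "h u \<in> W"
  obtains V A B E where "open V" "V \<subseteq> W" "h u \<in> V" "connected A" "connected B"
    "V - h ` \<sigma> = A \<union> B \<union> E" "(V \<inter> h ` \<sigma>) \<union> E \<subseteq> closure A \<inter> closure B"
    "E = {} \<longleftrightarrow> u \<in> rel_interior \<sigma>"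
proof -
  obtain n :: 'a where n: "n \<in> Basis" using nonempty_Basis by blast
  obtain \<psi> \<psi>' :: "'a \<Rightarrow> 'a" and f :: "'a \<Rightarrow> 'b" and e V where
    e: "e > 0" and V: "open V" "V \<subseteq> W" "homeomorphism (ball 0 e) V \<psi> \<psi>'" "\<psi> 0 = h u" and f: "linear f"
    "f ` {x. x \<bullet> n = 0} = span ((\<lambda>x. - u + x) ` \<sigma>)" "\<And>x. x \<bullet> n = 0 \<Longrightarrow> norm (f x) = norm x"
    and iff: "\<And>x. x \<in> ball 0 e \<Longrightarrow> \<psi> x \<in> h ` \<sigma> \<longleftrightarrow> x \<bullet> n = 0 \<and> u + f x \<in> \<sigma>"
    by (rule smooth_embedding_hyperplane_chart[OF h \<sigma> u W n]) (rule that)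
  have hull: "affine hull \<sigma> = (\<lambda>x. u + x) ` f ` {x. x \<bullet> n = 0}"
    using affine_hull_span_gen[of u \<sigma>] u f(2) by (simp add: hull_inc)
  \<comment> \<open>The radius is cut down so that the hyperplane piece around a relative interior
    point lies in \<open>\<sigma>\<close>; otherwise the chart radius serves.\<close>
  obtain d where d: "d > 0" "d \<le> e" "u \<in> rel_interior \<sigma> \<Longrightarrow> ball u d \<inter> affine hull \<sigma> \<subseteq> \<sigma>"
  proof (cases "u \<in> rel_interior \<sigma>")
    case True
    then obtain d where "d > 0" "ball u d \<inter> affine hull \<sigma> \<subseteq> \<sigma>"
      by (auto simp: mem_rel_interior_ball)
    moreover have "ball u (min d e) \<subseteq> ball u d" by auto
    ultimately show ?thesis using e by (intro that[of "min d e"]) (simp, simp, blast)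
  qed (use that[of e] e in auto)
  define N where "N = ball (0::'a) d"
  have N: "N \<subseteq> ball 0 e" "open N" "convex N" using d by (auto simp: N_def)
  have cont: "continuous_on N \<psi>"
    using V(3) N continuous_on_subset by (auto simp: homeomorphism_def)
  have inj: "inj_on \<psi> N"
    using homeomorphism_apply1[OF V(3)] N(1) by (metis inj_onI subsetD)
  define side where "side m = \<psi> ` (N \<inter> {x. 0 < m \<bullet> x})" for m
  define E where "E = \<psi> ` (N \<inter> {x. x \<bullet> n = 0 \<and> u + f x \<notin> \<sigma>})"
  have conn: "connected (side m)" for m
    unfolding side_def
    by (intro connected_continuous_image convex_connected convex_Int N convex_halfspace_gt
        continuous_on_subset[OF cont]) auto
  have cl: "\<psi> x \<in> closure (side m)" if x: "x \<in> N" "m \<bullet> x = 0" and m: "norm m = 1" for x m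
    unfolding closure_approachable
  proof (intro allI impI)
    fix r :: real assume r: "r > 0"
    have "open (N \<inter> \<psi> -` ball (\<psi> x) r)"
      using cont N(2) by (intro continuous_open_preimage) auto
    moreover have "x \<in> N \<inter> \<psi> -` ball (\<psi> x) r" using x r by auto
    ultimately obtain t where t: "t > 0" "ball x t \<subseteq> N \<inter> \<psi> -` ball (\<psi> x) r"
      using openE by blast
    define y where "y = x + (t/2) *\<^sub>R m"
    have "y \<in> ball x t" using t m by (auto simp: y_def dist_norm)
    moreover have "0 < m \<bullet> y" using t x m by (simp add: y_def inner_simps dot_square_norm)
    ultimately show "\<exists>y\<in>side m. dist y (\<psi> x) < r"
      using t(2) by (intro bexI[of _ "\<psi> y"]) (auto simp: side_def dist_commute)
  qed
  have nn: "norm n = 1" using n by simp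
  show ?thesis
  proof (rule that[of "\<psi> ` N" "side n" "side (- n)" E])
    have "openin (top_of_set V) (\<psi> ` N)"
      using homeomorphism_imp_open_map[OF V(3), of N] N by (simp add: open_subset)
    then show "open (\<psi> ` N)" using V(1) openin_open_trans by blast
    show "\<psi> ` N \<subseteq> W" using V(2,3) N(1) by (auto simp: homeomorphism_def)
    show "h u \<in> \<psi> ` N" using V(4) d(1) by (auto simp: N_def image_iff intro!: bexI[of _ 0])
    show "\<psi> ` N - h ` \<sigma> = side n \<union> side (- n) \<union> E"
    proof -
      have "\<psi> ` N - h ` \<sigma> = \<psi> ` (N \<inter> {x. \<not> (x \<bullet> n = 0 \<and> u + f x \<in> \<sigma>)})"
      proof (intro equalityI subsetI)
        fix y assume "y \<in> \<psi> ` N - h ` \<sigma>"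
        then obtain x where "x \<in> N" "y = \<psi> x" "\<psi> x \<notin> h ` \<sigma>" by auto
        then show "y \<in> \<psi> ` (N \<inter> {x. \<not> (x \<bullet> n = 0 \<and> u + f x \<in> \<sigma>)})"
          using iff[of x] N(1) by auto
      next
        fix y assume "y \<in> \<psi> ` (N \<inter> {x. \<not> (x \<bullet> n = 0 \<and> u + f x \<in> \<sigma>)})"
        then obtain x where "x \<in> N" "y = \<psi> x" "\<not> (x \<bullet> n = 0 \<and> u + f x \<in> \<sigma>)" by auto
        then show "y \<in> \<psi> ` N - h ` \<sigma>"
          using iff[of x] N(1) by (metis DiffI imageI subsetD)
      qed
      also have "N \<inter> {x. \<not> (x \<bullet> n = 0 \<and> u + f x \<in> \<sigma>)} =
          N \<inter> {x. 0 < n \<bullet> x} \<union> N \<inter> {x. 0 < (- n) \<bullet> x} \<union> N \<inter> {x. x \<bullet> n = 0 \<and> u + f x \<notin> \<sigma>}"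
        by (auto simp: inner_commute)
      finally show ?thesis by (simp add: image_Un side_def E_def)
    qed
    show "\<psi> ` N \<inter> h ` \<sigma> \<union> E \<subseteq> closure (side n) \<inter> closure (side (- n))"
    proof
      fix y assume "y \<in> \<psi> ` N \<inter> h ` \<sigma> \<union> E"
      then obtain x where x: "x \<in> N" "y = \<psi> x" "y \<in> h ` \<sigma> \<or> x \<bullet> n = 0"
        by (auto simp: E_def)
      then have "x \<bullet> n = 0" using iff[of x] N(1) by auto
      then show "y \<in> closure (side n) \<inter> closure (side (- n))"
        using x(1,2) cl[of x n] cl[of x "- n"] nn by (auto simp: inner_commute)
    qed
    show "E = {} \<longleftrightarrow> u \<in> rel_interior \<sigma>"
    proof
      assume u: "u \<in> rel_interior \<sigma>"
      have "u + f x \<in> \<sigma>" if "x \<in> N" "x \<bullet> n = 0" for x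
      proof -
        have "u + f x \<in> ball u d" using that f(3) by (simp add: N_def dist_norm)
        then show ?thesis using d(3)[OF u] hull that by auto
      qed
      then show "E = {}" by (auto simp: E_def)
    next
      assume E: "E = {}"
      have "ball u d \<inter> affine hull \<sigma> \<subseteq> \<sigma>"
      proof clarsimp
        fix v assume v: "dist u v < d" "v \<in> affine hull \<sigma>"
        then obtain x where x: "x \<bullet> n = 0" "v = u + f x" using hull by auto
        then have "x \<in> N" using f(3) v by (simp add: N_def dist_norm)
        then show "v \<in> \<sigma>" using E x by (auto simp: E_def)
      qed
      then show "u \<in> rel_interior \<sigma>" using u(1) d(1) by (auto simp: mem_rel_interior_ball assms(4))
    qed
  qed (use conn in auto)
qed

text \<open>Both pieces are open, so a ball around a point of either shrinks into that piece and the
  two sections never have to be compared.\<close>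

lemma flat_section_disjoint_Un:
  assumes "flat_section M a U s" "flat_section M a N t" "open U" "open N" "U \<inter> N = {}"
  shows "flat_section M a (U \<union> N) (\<lambda>x. if x \<in> N then t x else s x)" (is "flat_section M a _ ?r")
proof -
  have local: "flat_at M (U \<union> N) ?r p"
    if A: "flat_at M O' r p" "open O'" "p \<in> O'" "O' \<subseteq> U \<union> N" "\<And>x. x \<in> O' \<Longrightarrow> ?r x = r x" for O' r p
  proof -
    obtain e where e: "e > 0" "ball p e \<subseteq> M" "flat_on M r (ball p e \<inter> O')"
      using A(1) unfolding flat_at_def by blast
    obtain d where d: "d > 0" "ball p d \<subseteq> ball p e \<inter> O'"
      using openE[of "ball p e \<inter> O'" p] A(2,3) e(1) by auto
    have "flat_on M ?r (ball p d \<inter> (U \<union> N))"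
      unfolding flat_on_def
    proof (intro ballI)
      fix x y assume "x \<in> ball p d \<inter> (U \<union> N)" "y \<in> ball p d \<inter> (U \<union> N)"
      then have xy: "x \<in> ball p e \<inter> O'" "y \<in> ball p e \<inter> O'" using d(2) by auto
      then have "r y = transport M (r x) (linepath x y)" by (intro flat_onD[OF e(3)])
      then show "?r y = transport M (?r x) (linepath x y)"
        using A(5) xy by (metis IntD2)
    qed
    then show ?thesis using d e(2) unfolding flat_at_def by blast
  qed
  have "flat_at M (U \<union> N) ?r p" if "p \<in> U \<union> N" for p
  proof (cases "p \<in> N")
    case True
    show ?thesis by (rule local[of N t p]) (use True assms in \<open>auto simp: flat_section_def\<close>)
  next
    case False
    then have "p \<in> U" using that by simp
    show ?thesis by (rule local[of U s p]) (use \<open>p \<in> U\<close> assms in \<open>auto simp: flat_section_def\<close>)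
  qed
  then show ?thesis using assms unfolding flat_section_def by auto
qed

section \<open>Faces and relative interiors in a simplicial complex\<close>

lemma rel_interior_meets_faces:
  assumes K: "simplicial_complex K" and \<tau>: "\<tau> \<in> K" "u \<in> rel_interior \<tau>" and \<rho>: "\<rho> \<in> K" "u \<in> \<rho>"
  shows "\<tau> face_of \<rho>"
proof -
  have f: "\<tau> \<inter> \<rho> face_of \<tau>" "\<rho> \<inter> \<tau> face_of \<rho>"
    using K \<tau>(1) \<rho>(1) unfolding simplicial_complex_def by blast+
  have "u \<in> \<tau>" using \<tau>(2) rel_interior_subset by blast
  \<comment> \<open>A face of \<open>\<tau>\<close> that meets its relative interior is all of
    \<open>\<tau>\<close>.\<close>
  then have "\<tau> \<subseteq> \<tau> \<inter> \<rho>"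
    using \<tau>(2) \<rho>(2) by (intro subset_of_face_of[OF f(1)]) auto
  then have "\<rho> \<inter> \<tau> = \<tau>" by auto
  then show ?thesis using f(2) by simp
qed

lemma simplicial_complexD:
  assumes "simplicial_complex K" "\<sigma> \<in> K"
  shows "convex \<sigma>" "compact \<sigma>" "polyhedron \<sigma>" "\<And>F. F face_of \<sigma> \<Longrightarrow> F \<in> K"
proof -
  obtain n where n: "n simplex \<sigma>" using assms unfolding simplicial_complex_def by blast
  then show "convex \<sigma>" "compact \<sigma>"
    using convex_simplex compact_simplex by auto
  show "polyhedron \<sigma>"
    using n polytope_imp_polyhedron simplex_imp_polytope by blast
  show "\<And>F. F face_of \<sigma> \<Longrightarrow> F \<in> K"
    using assms unfolding simplicial_complex_def by blast
qed

lemma not_rel_interior_imp_facet: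
  assumes "simplicial_complex K" "\<sigma> \<in> K" "u \<in> \<sigma>" "u \<notin> rel_interior \<sigma>"
  obtains F where "F facet_of \<sigma>" "F \<in> K" "u \<in> F"
  using rel_boundary_of_polyhedron[OF simplicial_complexD(3)[OF assms(1,2)]] assms(3,4)
    simplicial_complexD(4)[OF assms(1,2)] facet_of_imp_face_of by blast

section \<open>Extension across collapses\<close>

locale smooth_complex =
  fixes K :: "'b::euclidean_space set set" and h :: "'b \<Rightarrow> real^4" and g :: "real^4 \<Rightarrow> 'b"
    and M :: "(real^4) set" and a :: "real^4"
  assumes K: "simplicial_complex K"
    and hom: "homeomorphism (\<Union>K) (h ` \<Union>K) h g"
    and smooth: "\<And>\<sigma>. \<sigma> \<in> K \<Longrightarrow> diffeomorphism \<sigma> (h ` \<sigma>) h g"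
    and M: "open M"
begin

definition skel2 :: "'b set set" where
  "skel2 = {\<rho> \<in> K. aff_dim \<rho> \<le> 2}"

text \<open>Keeping the 2-skeleton removed makes collapses of dimension at most 2 invisible, and a
  collapse of higher dimension then frees only open simplices of dimension 3 and 4.\<close>

definition obstacle :: "'b set set \<Rightarrow> (real^4) set" where
  "obstacle L = h ` \<Union>(L \<union> skel2)"

definition face_closed :: "'b set set \<Rightarrow> bool" where
  "face_closed L \<longleftrightarrow> L \<subseteq> K \<and> (\<forall>\<rho>\<in>L. \<forall>F. F face_of \<rho> \<longrightarrow> F \<in> L)"

lemma cont_h: "\<rho> \<in> K \<Longrightarrow> continuous_on \<rho> h"
  using hom continuous_on_subset[of "\<Union>K" h \<rho>] by (auto simp: homeomorphism_def)

lemma h_eq_iff: "\<lbrakk>x \<in> \<Union>K; y \<in> \<Union>K\<rbrakk> \<Longrightarrow> h x = h y \<longleftrightarrow> x = y"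
  using homeomorphism_apply1[OF hom] by metis

lemma closed_h_simplex: "\<rho> \<in> K \<Longrightarrow> closed (h ` \<rho>)"
  using compact_continuous_image[OF cont_h] simplicial_complexD(2)[OF K] compact_imp_closed by blast

lemma finite_K: "finite K"
  using K by (auto simp: simplicial_complex_def)

lemma closed_h_Union: "L \<subseteq> K \<Longrightarrow> closed (h ` \<Union>L)"
  using closed_h_simplex finite_K finite_subset by (auto simp: image_Union intro!: closed_UN)

lemma skel2_subset: "skel2 \<subseteq> K"
  by (auto simp: skel2_def)

lemma closed_obstacle: "L \<subseteq> K \<Longrightarrow> closed (obstacle L)"
  unfolding obstacle_def using skel2_subset by (intro closed_h_Union) auto

text \<open>The complex may lie in a larger space, but \<open>h\<close> embeds it in a 4-dimensional
  one, so invariance of dimension gives the bound.\<close>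

lemma aff_dim_le_4:
  assumes "\<sigma> \<in> K" shows "aff_dim \<sigma> \<le> 4"
proof (cases "\<sigma> = {}")
  case False
  have "aff_dim (affine hull \<sigma>) \<le> aff_dim (UNIV :: (real^4) set)"
  proof (rule invariance_of_dimension_affine_sets[of _ "rel_interior \<sigma>" _ h])
    show "continuous_on (rel_interior \<sigma>) h"
      using cont_h[OF assms] rel_interior_subset continuous_on_subset by blast
    show "inj_on h (rel_interior \<sigma>)"
      using h_eq_iff assms rel_interior_subset[of \<sigma>] unfolding inj_on_def by blast
    show "rel_interior \<sigma> \<noteq> {}"
      using False simplicial_complexD(1)[OF K assms] rel_interior_eq_empty by blast
  qed (auto simp: openin_rel_interior)
  then show ?thesis by simp
qed simp

text \<open>Removing from a ball the closed image of all simplices that miss \<open>u\<close> leaves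
  a neighbourhood met only by simplices through \<open>u\<close>, which have \<open>\<tau>\<close>
  as a face. The ball is returned too, as the convex set in which values are compared.\<close>

lemma star_neighbourhood:
  assumes \<tau>: "\<tau> \<in> K" "u \<in> rel_interior \<tau>" and u: "h u \<in> M"
  obtains W e where "open W" "h u \<in> W" "W \<subseteq> ball (h u) e" "ball (h u) e \<subseteq> M"
    "\<And>\<rho>. \<lbrakk>\<rho> \<in> K; W \<inter> h ` \<rho> \<noteq> {}\<rbrakk> \<Longrightarrow> \<tau> face_of \<rho>"
proof -
  obtain e where e: "e > 0" "ball (h u) e \<subseteq> M" using M u openE by blast
  define Z where "Z = h ` \<Union>{\<rho> \<in> K. u \<notin> \<rho>}"
  have uK: "u \<in> \<Union>K" using \<tau> rel_interior_subset by blast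
  have "closed Z" unfolding Z_def by (rule closed_h_Union) auto
  moreover have "h u \<notin> Z"
    unfolding Z_def using h_eq_iff[OF uK] by blast
  moreover have "\<tau> face_of \<rho>" if "\<rho> \<in> K" "(ball (h u) e - Z) \<inter> h ` \<rho> \<noteq> {}" for \<rho>
  proof -
    have "u \<in> \<rho>" using that unfolding Z_def by blast
    then show ?thesis using rel_interior_meets_faces[OF K \<tau> that(1)] by blast
  qed
  ultimately show ?thesis
    using e by (intro that[of "ball (h u) e - Z" e]) auto
qed

lemma rel_interior_not_in_face:
  assumes "\<sigma> \<in> K" "\<tau> face_of \<sigma>" "\<tau> \<noteq> \<sigma>" "u \<in> \<tau>"
  shows "u \<notin> rel_interior \<sigma>"
  using face_of_disjoint_rel_interior[OF assms(2,3)] assms(4) by blast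

lemma rel_interior_near:
  assumes "\<sigma> \<in> K" "u \<in> \<sigma>" "open V" "h u \<in> V"
  obtains v where "v \<in> rel_interior \<sigma>" "h v \<in> V"
proof -
  have "h u \<in> closure (h ` rel_interior \<sigma>)"
  proof -
    have "closure (rel_interior \<sigma>) = \<sigma>"
      using convex_closure_rel_interior[of \<sigma>] simplicial_complexD(1,2)[OF K assms(1)]
      by (simp add: compact_imp_closed)
    moreover have "h ` closure (rel_interior \<sigma>) \<subseteq> closure (h ` rel_interior \<sigma>)"
      using cont_h[OF assms(1)] calculation
      by (intro image_closure_subset) (simp_all add: closure_subset)
    ultimately show ?thesis using assms(2) by auto
  qed
  then show ?thesis
    using assms(3,4) that open_Int_closure_eq_empty[OF assms(3), of "h ` rel_interior \<sigma>"] by blast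
qed

text \<open>A remaining simplex with \<open>\<sigma>\<close> as a face would also have
  \<open>\<tau>\<close> as a face, against freeness.\<close>

lemma elementary_collapse_face_closed:
  assumes "face_closed L" "elementary_collapse L L'"
  shows "face_closed L'"
proof -
  obtain \<sigma> \<tau> where st: "\<sigma> \<in> L" "\<tau> \<in> L" "\<tau> facet_of \<sigma>" "\<forall>\<rho>\<in>L. \<tau> face_of \<rho> \<longrightarrow> \<rho> = \<tau> \<or> \<rho> = \<sigma>"
      "L' = L - {\<sigma>, \<tau>}"
    using assms(2) unfolding elementary_collapse_def by blast
  have "F \<in> L'" if \<rho>: "\<rho> \<in> L'" "F face_of \<rho>" for F \<rho>
  proof -
    have "F \<in> L" using assms(1) \<rho> st(5) by (auto simp: face_closed_def)
    moreover have "\<not> \<tau> face_of \<rho>" using st(4,5) \<rho>(1) by blast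
    moreover have "\<sigma> face_of \<rho> \<Longrightarrow> \<tau> face_of \<rho>"
      using face_of_trans[OF facet_of_imp_face_of[OF st(3)]] .
    ultimately show ?thesis using st(5) \<rho>(2) by auto
  qed
  moreover have "L' \<subseteq> K" using assms(1) st(5) unfolding face_closed_def by blast
  ultimately show ?thesis unfolding face_closed_def by blast
qed

text \<open>This serves both kinds of walls: a collapsing 3-simplex, and the free facet of a
  collapsing 4-simplex. All that each case has to supply, besides the local pictures, is one wall
  point where the section is flat.\<close>

lemma flat_section_extend_wall:
  assumes s: "flat_section M a U s" and \<sigma>: "\<sigma> \<in> K" "\<sigma> \<noteq> {}"
    and v: "v \<in> rel_interior \<sigma>" "flat_at M U s (h v)" and WM: "h ` rel_interior \<sigma> \<subseteq> M"
    and two_sided: "\<And>u. u \<in> rel_interior \<sigma> \<Longrightarrow>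
      \<exists>V C A B. open V \<and> h u \<in> V \<and> V \<subseteq> C \<and> convex C \<and> C \<subseteq> M \<and> connected A \<and> connected B \<and>
         V \<inter> U = A \<union> B \<and> V \<inter> h ` \<sigma> \<subseteq> closure A \<inter> closure B"
  obtains s' where "flat_section M a (U \<union> h ` rel_interior \<sigma>) s'" "\<And>x. x \<in> U \<Longrightarrow> s' x = s x"
proof -
  let ?W = "h ` rel_interior \<sigma>"
  have sub: "?W \<subseteq> h ` \<sigma>" using rel_interior_subset by blast
  have conn: "connected ?W"
    using simplicial_complexD(1)[OF K \<sigma>(1)] rel_interior_subset
    by (intro connected_continuous_image continuous_on_subset[OF cont_h[OF \<sigma>(1)]])
      (auto intro: convex_connected convex_rel_interior)
  have ts: "\<exists>V C A B. open V \<and> u \<in> V \<and> V \<subseteq> C \<and> convex C \<and> C \<subseteq> M \<and>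
          connected A \<and> connected B \<and> V \<inter> U = A \<union> B \<and> V \<inter> ?W \<subseteq> closure A \<inter> closure B"
    if u: "u \<in> ?W" for u
  proof -
    obtain w where w: "w \<in> rel_interior \<sigma>" "u = h w" using u by blast
    show ?thesis
      using two_sided[OF w(1)] unfolding w(2) by (elim ex_forward conj_forward) (use sub in blast)+
  qed
  have flat: "flat_at M U s p" if "p \<in> ?W" for p
    using flat_at_wall[OF s conn _ v(2) that] v(1) ts by blast
  have "?W \<subseteq> closure U"
  proof
    fix p assume "p \<in> ?W"
    with ts[OF this] show "p \<in> closure U"
      by (metis (no_types, lifting) IntE IntI UnCI closure_mono subset_iff)
  qed
  then have "U \<union> ?W \<subseteq> closure U" using closure_subset by blast
  moreover have "flat_at M U s p" if "p \<in> U \<union> ?W" for p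
    using that flat s by (auto simp: flat_section_def)
  ultimately obtain s' where "flat_section M a (U \<union> ?W) s'" "\<And>x. x \<in> U \<Longrightarrow> s' x = s x"
    using flat_section_extend[OF s Un_upper1] by blast
  then show ?thesis by (rule that)
qed

text \<open>At an interior point of the free 2-face \<open>\<tau>\<close> the set \<open>E\<close>
  is nonempty, so a small neighbourhood minus the wall is connected and the section is flat on it.
  Interior points of \<open>\<sigma>\<close> nearby provide the flat wall point.\<close>

lemma extend_dim_3:
  assumes L: "face_closed L" and st: "\<sigma> \<in> L" "\<tau> \<in> L" "\<tau> facet_of \<sigma>"
      "\<And>\<rho>. \<lbrakk>\<rho> \<in> L; \<tau> face_of \<rho>\<rbrakk> \<Longrightarrow> \<rho> = \<tau> \<or> \<rho> = \<sigma>" "L' = L - {\<sigma>, \<tau>}"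
    and dim: "aff_dim \<sigma> = 3" and D: "h ` \<Union>K - M \<subseteq> h ` \<Union>L'"
    and s: "flat_section M a (M - obstacle L) s"
  obtains s' where "flat_section M a (M - obstacle L') s'" "\<And>x. x \<in> M - obstacle L \<Longrightarrow> s' x = s x"
proof -
  have LK: "L \<subseteq> K" using L by (simp add: face_closed_def)
  have K': "\<sigma> \<in> K" "\<tau> \<in> K" using LK st by auto
  have \<tau>: "\<tau> face_of \<sigma>" "\<tau> \<noteq> {}" "aff_dim \<tau> = 2" "\<tau> \<noteq> \<sigma>" "\<tau> \<subseteq> \<sigma>"
    using st(3) dim facet_of_imp_subset[OF st(3)] by (auto simp: facet_of_def)
  let ?U = "M - obstacle L"
  \<comment> \<open>Freeness settles the simplices of \<open>L\<close>; one from the 2-skeleton that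
    has the 2-dimensional face \<open>\<tau>\<close> can only be \<open>\<tau>\<close>.\<close>
  have meets: "\<rho> \<subseteq> \<sigma>" if "\<rho> \<in> L \<union> skel2" "\<tau> face_of \<rho>" for \<rho>
  proof (cases "\<rho> \<in> L")
    case True then show ?thesis using st(4)[OF _ that(2)] \<tau>(5) by auto
  next
    case False
    then have "aff_dim \<rho> \<le> 2" "\<rho> \<in> K" using that by (auto simp: skel2_def)
    then have "\<rho> = \<tau>"
      using face_of_aff_dim_lt[OF simplicial_complexD(1)[OF K] that(2)] \<tau>(3) by auto
    then show ?thesis using \<tau>(5) by simp
  qed
  \<comment> \<open>A point outside \<open>M\<close> is covered by a simplex of \<open>L'\<close>;
    that simplex would have \<open>\<tau>\<close> as a face, against freeness.\<close>
  have inM: "h u \<in> M" if u: "u \<in> rel_interior \<sigma> \<or> u \<in> rel_interior \<tau>" for u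
  proof (rule ccontr)
    assume "h u \<notin> M"
    have uK: "u \<in> \<Union>K" using u K' rel_interior_subset by blast
    then obtain \<rho> where \<rho>: "\<rho> \<in> L'" "h u \<in> h ` \<rho>" using D \<open>h u \<notin> M\<close> by blast
    have "u \<in> \<rho>" using \<rho> h_eq_iff[OF uK] LK st(5) by blast
    then have "\<tau> face_of \<rho>"
      using u rel_interior_meets_faces[OF K] K' \<rho>(1) LK st(5) \<tau>(1) face_of_trans by blast
    then show False using st(4,5) \<rho>(1) by blast
  qed
  have nb: "\<exists>V C A B E. open V \<and> h u \<in> V \<and> V \<subseteq> C \<and> convex C \<and> C \<subseteq> M \<and> connected A \<and> connected B \<and>
      V \<inter> ?U = A \<union> B \<union> E \<and> (V \<inter> h ` \<sigma>) \<union> E \<subseteq> closure A \<inter> closure B \<and>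
      (E = {} \<longleftrightarrow> u \<in> rel_interior \<sigma>)"
    if \<mu>: "\<mu> = \<sigma> \<or> \<mu> = \<tau>" "u \<in> rel_interior \<mu>" for u \<mu>
  proof -
    have \<mu>K: "\<mu> \<in> K" and u\<sigma>: "u \<in> \<sigma>" and uM: "h u \<in> M"
      using \<mu> K' rel_interior_subset \<tau>(5) inM by blast+
    obtain W e where W: "open W" "h u \<in> W" "W \<subseteq> ball (h u) e" "ball (h u) e \<subseteq> M"
        "\<And>\<rho>. \<lbrakk>\<rho> \<in> K; W \<inter> h ` \<rho> \<noteq> {}\<rbrakk> \<Longrightarrow> \<mu> face_of \<rho>"
      using star_neighbourhood[OF \<mu>K \<mu>(2) uM] by blast
    obtain V A B E where V: "open V" "V \<subseteq> W" "h u \<in> V" "connected A" "connected B"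
        "V - h ` \<sigma> = A \<union> B \<union> E" "(V \<inter> h ` \<sigma>) \<union> E \<subseteq> closure A \<inter> closure B"
        "E = {} \<longleftrightarrow> u \<in> rel_interior \<sigma>"
      by (rule smooth_simplex_two_sided[OF smooth[OF K'(1)] simplicial_complexD(1)[OF K K'(1)] _ u\<sigma> W(1,2)])
        (use dim in auto)
    have "V \<inter> obstacle L \<subseteq> h ` \<sigma>"
    proof
      fix x assume x: "x \<in> V \<inter> obstacle L"
      then obtain \<rho> where \<rho>: "\<rho> \<in> L \<union> skel2" "x \<in> h ` \<rho>" by (auto simp: obstacle_def)
      then have "\<mu> face_of \<rho>" using W(5)[of \<rho>] x V(2) LK skel2_subset by blast
      then have "\<tau> face_of \<rho>" using \<mu>(1) \<tau>(1) face_of_trans by blast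
      then show "x \<in> h ` \<sigma>" using meets \<rho> by blast
    qed
    moreover have "h ` \<sigma> \<subseteq> obstacle L" using st(1) by (auto simp: obstacle_def)
    ultimately have "V \<inter> ?U = V - h ` \<sigma>" using V(2) W(3,4) by blast
    with V(6) have "V \<inter> ?U = A \<union> B \<union> E" by simp
    moreover have "V \<subseteq> ball (h u) e" using V(2) W(3) by blast
    ultimately show ?thesis
      using V(1,3,4,5,7,8) W(4) convex_ball by (metis (no_types, lifting))
  qed
  obtain v where v: "v \<in> rel_interior \<sigma>" "flat_at M ?U s (h v)"
  proof -
    obtain u where u: "u \<in> rel_interior \<tau>"
      using \<tau>(2) simplicial_complexD(1)[OF K K'(2)] rel_interior_eq_empty by blast
    then have ur: "u \<in> \<sigma>" "u \<notin> rel_interior \<sigma>"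
      using rel_interior_not_in_face[OF K'(1) \<tau>(1,4)] \<tau>(5) rel_interior_subset by blast+
    from nb[OF disjI2[OF refl] u] obtain V C A B E where V: "open V" "h u \<in> V" "V \<subseteq> C" "convex C" "C \<subseteq> M"
        "connected A" "connected B" "V \<inter> ?U = A \<union> B \<union> E" "(V \<inter> h ` \<sigma>) \<union> E \<subseteq> closure A \<inter> closure B"
        "E = {} \<longleftrightarrow> u \<in> rel_interior \<sigma>"
      by (elim exE conjE) (rule that; assumption)
    \<comment> \<open>\<open>E\<close> lies in both closures, so it may be added to either side;
      being nonempty, it then joins them.\<close>
    have "connected (A \<union> E)" "connected (B \<union> E)"
      using connected_intermediate_closure[OF V(6), of "A \<union> E"]
        connected_intermediate_closure[OF V(7), of "B \<union> E"] V(9) closure_subset by auto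
    then have "connected ((A \<union> E) \<union> (B \<union> E))"
      using V(10) ur(2) by (intro connected_Un[of "A \<union> E" "B \<union> E"]) auto
    moreover have "(A \<union> E) \<union> (B \<union> E) = V \<inter> ?U" using V(8) by auto
    ultimately have fl: "flat_on M s (V \<inter> ?U)"
      using V by (intro flat_on_connected[OF s, of _ C]) auto
    obtain v where v: "v \<in> rel_interior \<sigma>" "h v \<in> V"
      using rel_interior_near[OF K'(1) ur(1) V(1,2)] .
    obtain d where d: "d > 0" "ball (h v) d \<subseteq> V" using V(1) v(2) openE by blast
    then have "flat_at M ?U s (h v)"
      using V(3,5) fl unfolding flat_at_def by (intro exI[of _ d]) (auto elim!: flat_on_subset)
    then show ?thesis using that v by blast
  qed
  have ts: "\<exists>V C A B. open V \<and> h u \<in> V \<and> V \<subseteq> C \<and> convex C \<and> C \<subseteq> M \<and> connected A \<and> connected B \<and>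
         V \<inter> ?U = A \<union> B \<and> V \<inter> h ` \<sigma> \<subseteq> closure A \<inter> closure B" if "u \<in> rel_interior \<sigma>" for u
    using nb[OF _ that] that by (metis (no_types, lifting) Un_empty_right)
  obtain s' where s': "flat_section M a (?U \<union> h ` rel_interior \<sigma>) s'" "\<And>x. x \<in> ?U \<Longrightarrow> s' x = s x"
    using flat_section_extend_wall[OF s K'(1) _ v _ ts] inM v(1) rel_interior_subset by blast
  \<comment> \<open>The facets of \<open>\<sigma>\<close> have dimension 2 and stay in the obstacle,
    so only its relative interior is freed.\<close>
  have "M - obstacle L' \<subseteq> ?U \<union> h ` rel_interior \<sigma>"
  proof
    fix x assume x: "x \<in> M - obstacle L'"
    show "x \<in> ?U \<union> h ` rel_interior \<sigma>"
    proof (cases "x \<in> obstacle L")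
      case True
      then have "x \<in> h ` \<sigma>" using x \<tau>(5) st(5) by (auto simp: obstacle_def)
      then obtain u where u: "u \<in> \<sigma>" "x = h u" by auto
      have "u \<in> rel_interior \<sigma>"
      proof (rule ccontr)
        assume "u \<notin> rel_interior \<sigma>"
        then obtain F where F: "F facet_of \<sigma>" "F \<in> K" "u \<in> F"
          using not_rel_interior_imp_facet[OF K K'(1) u(1)] by blast
        then have "F \<in> skel2" using dim by (auto simp: skel2_def facet_of_def)
        then show False using x u F by (auto simp: obstacle_def)
      qed
      then show ?thesis using u by blast
    qed (use x in auto)
  qed
  then show ?thesis
    using that[of s'] flat_section_subset[OF s'(1)] s'(2) by blast
qed

lemma open_h_rel_interior:
  assumes "\<sigma> \<in> K" "aff_dim \<sigma> = 4"
  shows "open (h ` rel_interior \<sigma>)"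
proof -
  have "openin (top_of_set UNIV) (h ` rel_interior \<sigma>)"
  proof (rule invariance_of_domain_affine_sets[of "affine hull \<sigma>"])
    show "continuous_on (rel_interior \<sigma>) h"
      using cont_h[OF assms(1)] rel_interior_subset continuous_on_subset by blast
    show "inj_on h (rel_interior \<sigma>)"
      using h_eq_iff assms rel_interior_subset[of \<sigma>] unfolding inj_on_def by blast
  qed (use assms(2) in \<open>auto simp: openin_rel_interior\<close>)
  then show ?thesis by simp
qed

text \<open>Invariance of domain for \<open>g\<close> turns an open set inside the simplex into a
  relatively open subset of its affine hull. The lemma rules out that a 4-simplex fills both sides
  of its own facet.\<close>

lemma open_subset_h_simplex:
  assumes "\<sigma> \<in> K" "aff_dim \<sigma> = 4" "open V" "V \<subseteq> h ` \<sigma>"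
  shows "V \<subseteq> h ` rel_interior \<sigma>"
proof -
  have sub: "h ` \<sigma> \<subseteq> h ` \<Union>K" using assms(1) by auto
  have gh: "g (h x) = x" if "x \<in> \<sigma>" for x
    using homeomorphism_apply1[OF hom] that assms(1) by auto
  have gV: "g ` V \<subseteq> \<sigma>" using assms(4) gh by (auto simp: subset_iff image_iff)
  have "openin (top_of_set (affine hull \<sigma>)) (g ` V)"
  proof (rule invariance_of_domain_affine_sets[of UNIV])
    show "continuous_on V g"
      using hom assms(4) sub continuous_on_subset[of "h ` \<Union>K" g V] by (auto simp: homeomorphism_def)
    show "inj_on g V"
      using homeomorphism_apply2[OF hom] assms(4) sub by (metis inj_onI subsetD)
    show "g \<in> V \<rightarrow> affine hull \<sigma>" using gV hull_subset[of \<sigma> affine] by auto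
  qed (use assms in auto)
  then have "g ` V \<subseteq> rel_interior \<sigma>"
    using gV rel_interior_maximal by blast
  moreover have "h (g y) = y" if "y \<in> V" for y
    using homeomorphism_apply2[OF hom, of y] that assms(4) sub by blast
  then have "V = h ` g ` V" by (simp add: image_image)
  ultimately show ?thesis by blast
qed

text \<open>The open simplex \<open>N\<close> is a fresh piece of the domain without any value. One
  is carried over at a single point of the facet, spread over \<open>N\<close> by simple
  connectivity, and then matches along the whole facet because that wall is connected.\<close>

lemma extend_dim_4:
  assumes L: "face_closed L" and st: "\<sigma> \<in> L" "\<tau> \<in> L" "\<tau> facet_of \<sigma>"
      "\<And>\<rho>. \<lbrakk>\<rho> \<in> L; \<tau> face_of \<rho>\<rbrakk> \<Longrightarrow> \<rho> = \<tau> \<or> \<rho> = \<sigma>" "L' = L - {\<sigma>, \<tau>}"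
    and dim: "aff_dim \<sigma> = 4" and D: "h ` \<Union>K - M \<subseteq> h ` \<Union>L'"
    and s: "flat_section M a (M - obstacle L) s"
  obtains s' where "flat_section M a (M - obstacle L') s'" "\<And>x. x \<in> M - obstacle L \<Longrightarrow> s' x = s x"
proof -
  have LK: "L \<subseteq> K" using L by (simp add: face_closed_def)
  have K': "\<sigma> \<in> K" "\<tau> \<in> K" using LK st by auto
  have \<tau>: "\<tau> face_of \<sigma>" "\<tau> \<noteq> {}" "aff_dim \<tau> = 3" "\<tau> \<noteq> \<sigma>" "\<tau> \<subseteq> \<sigma>"
    using st(3) dim facet_of_imp_subset[OF st(3)] by (auto simp: facet_of_def)
  define U where "U = M - obstacle L"
  define N where "N = h ` rel_interior \<sigma>"
  have h\<sigma>: "h ` \<sigma> \<subseteq> obstacle L" "N \<subseteq> h ` \<sigma>" "h ` \<tau> \<subseteq> h ` \<sigma>"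
    using st(1) rel_interior_subset \<tau>(5) by (auto simp: obstacle_def N_def)
  have openU: "open U" unfolding U_def using M closed_obstacle[OF LK] by auto
  have openN: "open N" unfolding N_def by (rule open_h_rel_interior[OF K'(1) dim])
  have UN: "U \<inter> N = {}" using h\<sigma>(1,2) unfolding U_def by blast
  have \<tau>N: "h ` \<tau> \<inter> N = {}"
  proof -
    have "h u \<noteq> h v" if "u \<in> \<tau>" "v \<in> rel_interior \<sigma>" for u v
      using that h_eq_iff[of u v] K' rel_interior_not_in_face[OF K'(1) \<tau>(1,4)] rel_interior_subset by blast
    then show ?thesis by (auto simp: N_def)
  qed
  have meets: "\<rho> \<subseteq> \<sigma>" if "\<rho> \<in> L \<union> skel2" "\<tau> face_of \<rho>" for \<rho>
  proof (cases "\<rho> \<in> L")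
    case True then show ?thesis using st(4)[OF _ that(2)] \<tau>(5) by auto
  next
    case False
    then have "aff_dim \<rho> \<le> 2" using that by (auto simp: skel2_def)
    then show ?thesis using aff_dim_subset[OF face_of_imp_subset[OF that(2)]] \<tau>(3) by simp
  qed
  have inM: "h u \<in> M" if u: "u \<in> rel_interior \<sigma> \<or> u \<in> rel_interior \<tau>" for u
  proof (rule ccontr)
    assume "h u \<notin> M"
    have uK: "u \<in> \<Union>K" using u K' rel_interior_subset by blast
    then obtain \<rho> where \<rho>: "\<rho> \<in> L'" "h u \<in> h ` \<rho>" using D \<open>h u \<notin> M\<close> by blast
    have "u \<in> \<rho>" using \<rho> h_eq_iff[OF uK] LK st(5) by blast
    then have "\<tau> face_of \<rho>"
      using u rel_interior_meets_faces[OF K] K' \<rho>(1) LK st(5) \<tau>(1) face_of_trans by blast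
    then show False using st(4,5) \<rho>(1) by blast
  qed
  have NM: "N \<subseteq> M" using inM by (auto simp: N_def)
  have nb: "\<exists>V C A B. open V \<and> h u \<in> V \<and> V \<subseteq> C \<and> convex C \<and> C \<subseteq> M \<and> connected A \<and> connected B \<and>
      V - h ` \<tau> = A \<union> B \<and> V \<inter> h ` \<tau> \<subseteq> closure A \<inter> closure B \<and> A \<subseteq> N \<and> B \<subseteq> U"
    if u: "u \<in> rel_interior \<tau>" for u
  proof -
    have u\<tau>: "u \<in> \<tau>" and uM: "h u \<in> M"
      using u rel_interior_subset inM by blast+
    obtain W e where W: "open W" "h u \<in> W" "W \<subseteq> ball (h u) e" "ball (h u) e \<subseteq> M"
        "\<And>\<rho>. \<lbrakk>\<rho> \<in> K; W \<inter> h ` \<rho> \<noteq> {}\<rbrakk> \<Longrightarrow> \<tau> face_of \<rho>"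
      using star_neighbourhood[OF K'(2) u uM] by blast
    obtain V A B E where V: "open V" "V \<subseteq> W" "h u \<in> V" "connected A" "connected B"
        "V - h ` \<tau> = A \<union> B \<union> E" "(V \<inter> h ` \<tau>) \<union> E \<subseteq> closure A \<inter> closure B"
        "E = {} \<longleftrightarrow> u \<in> rel_interior \<tau>"
      by (rule smooth_simplex_two_sided[OF smooth[OF K'(2)] simplicial_complexD(1)[OF K K'(2)] _ u\<tau> W(1,2)])
        (use \<tau>(3) in auto)
    have E: "E = {}" using V(8) u by simp
    have VAB: "V - h ` \<tau> = A \<union> B" and Vcl: "V \<inter> h ` \<tau> \<subseteq> closure A \<inter> closure B"
      using V(6,7) E by auto
    have AV: "A \<subseteq> V" "B \<subseteq> V" using VAB by auto
    have "V \<inter> obstacle L \<subseteq> h ` \<sigma>"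
    proof
      fix x assume x: "x \<in> V \<inter> obstacle L"
      then obtain \<rho> where \<rho>: "\<rho> \<in> L \<union> skel2" "x \<in> h ` \<rho>" by (auto simp: obstacle_def)
      then have "\<tau> face_of \<rho>" using W(5)[of \<rho>] x V(2) LK skel2_subset by blast
      then show "x \<in> h ` \<sigma>" using meets \<rho> by blast
    qed
    moreover have VM: "V \<subseteq> M" using V(2) W(3,4) by blast
    ultimately have VU: "V - h ` \<sigma> \<subseteq> U" by (auto simp: U_def)
    \<comment> \<open>Every simplex met by \<open>V\<close> has \<open>\<tau>\<close> as a face, so
      \<open>\<tau>\<close> is the only facet of \<open>\<sigma>\<close> met there.\<close>
    have V\<sigma>: "V \<inter> h ` \<sigma> \<subseteq> N \<union> h ` \<tau>"
    proof
      fix x assume x: "x \<in> V \<inter> h ` \<sigma>"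
      then obtain v where v: "v \<in> \<sigma>" "x = h v" by auto
      show "x \<in> N \<union> h ` \<tau>"
      proof (cases "v \<in> rel_interior \<sigma>")
        case False
        then obtain F where F: "F facet_of \<sigma>" "F \<in> K" "v \<in> F"
          using not_rel_interior_imp_facet[OF K K'(1) v(1)] by blast
        then have "\<tau> face_of F" using W(5)[of F] x v V(2) by blast
        moreover have "aff_dim F = aff_dim \<tau>" using F(1) \<tau>(3) dim by (simp add: facet_of_def)
        ultimately have "F = \<tau>"
          using face_of_aff_dim_lt[OF simplicial_complexD(1)[OF K F(2)], of \<tau>] by auto
        then show ?thesis using F v by auto
      qed (use v in \<open>auto simp: N_def\<close>)
    qed
    have VC: "V \<subseteq> ball (h u) e" using V(2) W(3) by blast
    \<comment> \<open>Off the facet, \<open>V\<close> splits into the open simplex and the open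
      complement of the closed one; a connected set chooses one of them.\<close>
    have dich: "Q \<subseteq> N \<or> Q \<subseteq> - h ` \<sigma>" if Q: "connected Q" "Q \<subseteq> V - h ` \<tau>" for Q
    proof -
      have "Q \<subseteq> N \<union> - h ` \<sigma>" using Q(2) V\<sigma> by blast
      moreover have "N \<inter> - h ` \<sigma> = {}" using h\<sigma>(2) by auto
      moreover have "open (- h ` \<sigma>)" using closed_h_simplex[OF K'(1)] by auto
      ultimately have "N \<inter> Q = {} \<or> - h ` \<sigma> \<inter> Q = {}"
        using connectedD[OF Q(1) openN, of "- h ` \<sigma>"] by auto
      then show ?thesis using Q(2) V\<sigma> by blast
    qed
    \<comment> \<open>Not both sides avoid the simplex, since its interior points accumulate at the
      facet. Not both lie in \<open>N\<close>, since \<open>V\<close> would then be an open part of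
      the simplex containing its boundary point \<open>h u\<close>.\<close>
    have "\<not> (A \<subseteq> - h ` \<sigma> \<and> B \<subseteq> - h ` \<sigma>)"
    proof
      assume AB: "A \<subseteq> - h ` \<sigma> \<and> B \<subseteq> - h ` \<sigma>"
      have "u \<in> \<sigma>" using u\<tau> \<tau>(5) by auto
      then obtain v where "v \<in> rel_interior \<sigma>" "h v \<in> V"
        using rel_interior_near[OF K'(1) _ V(1,3)] by blast
      then have hv: "h v \<in> V" "h v \<in> N" by (auto simp: N_def)
      then have "h v \<in> V - h ` \<tau>" using \<tau>N by blast
      then have "h v \<in> A \<union> B" using VAB by simp
      then show False using AB hv(2) h\<sigma>(2) by blast
    qed
    moreover have "\<not> (A \<subseteq> N \<and> B \<subseteq> N)"
    proof
      assume "A \<subseteq> N \<and> B \<subseteq> N"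
      then have "V \<subseteq> h ` \<sigma>" using VAB h\<sigma>(2,3) by blast
      then have "V \<subseteq> N" using open_subset_h_simplex[OF K'(1) dim V(1)] by (simp add: N_def)
      then show False using V(3) \<tau>N u\<tau> by blast
    qed
    moreover have "A \<subseteq> V - h ` \<tau>" "B \<subseteq> V - h ` \<tau>" using VAB by auto
    ultimately consider "A \<subseteq> N" "B \<subseteq> - h ` \<sigma>" | "B \<subseteq> N" "A \<subseteq> - h ` \<sigma>"
      using dich[OF V(4)] dich[OF V(5)] by blast
    then show ?thesis
    proof cases
      case 1
      then have "B \<subseteq> U" using VU AV by blast
      then show ?thesis
        using 1(1) V(1,3-5) VC W(4) VAB Vcl convex_ball by (metis (no_types, lifting))
    next
      case 2
      then have "A \<subseteq> U" using VU AV by blast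
      then show ?thesis
        using 2(1) V(1,3-5) VC W(4) VAB Vcl convex_ball by (metis (no_types, lifting) Un_commute Int_commute)
    qed
  qed
  have nonempty: "A \<noteq> {} \<and> B \<noteq> {}" if "V \<inter> h ` \<tau> \<subseteq> closure A \<inter> closure B" "x \<in> V \<inter> h ` \<tau>"
    for A B V :: "(real^4) set" and x
    using that by auto
  obtain u0 where u0: "u0 \<in> rel_interior \<tau>"
    using \<tau>(2) simplicial_complexD(1)[OF K K'(2)] rel_interior_eq_empty by blast
  then have u0\<tau>: "u0 \<in> \<tau>" using rel_interior_subset by blast
  obtain V C A B where V: "open V" "h u0 \<in> V" "V \<subseteq> C" "convex C" "C \<subseteq> M" "connected A" "connected B"
      "V - h ` \<tau> = A \<union> B" "V \<inter> h ` \<tau> \<subseteq> closure A \<inter> closure B" "A \<subseteq> N" "B \<subseteq> U"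
    using nb[OF u0] by (elim exE conjE) (rule that; assumption)
  have AB: "A \<subseteq> C" "B \<subseteq> C" using V(3,8) by auto
  obtain x0 x1 where x: "x0 \<in> A" "x1 \<in> B"
    using nonempty[OF V(9), of "h u0"] V(2) u0\<tau> by blast
  note fib = flat_section_fibre[OF s[folded U_def]]
  \<comment> \<open>The value at \<open>x0\<close> is forced: it has to be the one that arrives from
    \<open>x1\<close> straight across the wall.\<close>
  have b0: "transport M (s x1) (linepath x1 x0) \<in> path_fibre M a x0"
    using x V(11) AB by (intro transport_linepath_in_path_fibre[OF fib V(4,5)]) auto
  have "simply_connected N"
  proof -
    have "rel_interior \<sigma> homeomorphic N"
      unfolding N_def homeomorphic_def
      using homeomorphism_of_subsets[OF hom, of "rel_interior \<sigma>"] K'(1) rel_interior_subset by blast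
    moreover have "simply_connected (rel_interior \<sigma>)"
      using simplicial_complexD(1)[OF K K'(1)] by (intro convex_imp_simply_connected convex_rel_interior)
    ultimately show ?thesis by (rule homeomorphic_simply_connected)
  qed
  then obtain t where t: "flat_section M a N t" "t x0 = transport M (s x1) (linepath x1 x0)"
    using simply_connected_flat_section[OF openN _ NM _ b0] x V(10) by blast
  define r where "r x = (if x \<in> N then t x else s x)" for x
  have r: "flat_section M a (U \<union> N) r"
    using flat_section_disjoint_Un[OF s[folded U_def] t(1) openU openN UN] by (simp add: r_def[abs_def])
  have rs: "r x = s x" if "x \<in> U" for x using that UN by (auto simp: r_def)
  have cap: "V' \<inter> (U \<union> N) = A' \<union> B'" if "V' - h ` \<tau> = A' \<union> B'" "A' \<subseteq> N" "B' \<subseteq> U" for V' A' B'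
  proof -
    have "(U \<union> N) \<inter> h ` \<tau> = {}" using \<tau>N h\<sigma> unfolding U_def by blast
    with that show ?thesis by blast
  qed
  have "flat_on M r (B \<union> A)"
  proof (rule flat_on_Un[OF flat_section_fibre[OF r] V(4,5) AB(2,1) _ _ x(2,1)])
    show "flat_on M r A" "flat_on M r B"
      using V AB by (auto intro!: flat_on_connected[OF r _ _ _ V(4,5)])
    show "r x0 = transport M (r x1) (linepath x1 x0)"
      using t(2) x V(10,11) rs[of x1] by (auto simp: r_def)
  qed (use V in auto)
  then have fl: "flat_on M r (V \<inter> (U \<union> N))"
    using cap[OF V(8,10,11)] by (simp add: Un_commute)
  obtain d where d: "d > 0" "ball (h u0) d \<subseteq> V" using V(1,2) openE by blast
  have flat0: "flat_at M (U \<union> N) r (h u0)"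
    unfolding flat_at_def
  proof (intro exI conjI)
    show "flat_on M r (ball (h u0) d \<inter> (U \<union> N))" using fl d(2) by (auto elim!: flat_on_subset)
    show "ball (h u0) d \<subseteq> M" using d(2) V(3,5) by blast
  qed (use d in auto)
  have ts: "\<exists>V C A B. open V \<and> h u \<in> V \<and> V \<subseteq> C \<and> convex C \<and> C \<subseteq> M \<and> connected A \<and> connected B \<and>
         V \<inter> (U \<union> N) = A \<union> B \<and> V \<inter> h ` \<tau> \<subseteq> closure A \<inter> closure B" if "u \<in> rel_interior \<tau>" for u
    using nb[OF that] cap by metis
  have "h ` rel_interior \<tau> \<subseteq> M" using inM by auto
  then obtain s' where s': "flat_section M a (U \<union> N \<union> h ` rel_interior \<tau>) s'" "\<And>x. x \<in> U \<union> N \<Longrightarrow> s' x = r x"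
    using flat_section_extend_wall[OF r K'(2) \<tau>(2) u0 flat0 _ ts] by blast
  \<comment> \<open>Besides \<open>N\<close> only the relative interior of \<open>\<tau>\<close> is
    freed: the other facets of \<open>\<sigma>\<close> stay in \<open>L'\<close>, and the facets of
    \<open>\<tau>\<close> stay in the 2-skeleton.\<close>
  have "M - obstacle L' \<subseteq> U \<union> N \<union> h ` rel_interior \<tau>"
  proof
    fix x assume x: "x \<in> M - obstacle L'"
    show "x \<in> U \<union> N \<union> h ` rel_interior \<tau>"
    proof (cases "x \<in> obstacle L")
      case True
      then have "x \<in> h ` \<sigma>" using x \<tau>(5) st(5) by (auto simp: obstacle_def)
      then obtain u where u: "u \<in> \<sigma>" "x = h u" by auto
      show ?thesis
      proof (cases "u \<in> rel_interior \<sigma>")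
        case False
        then obtain F where F: "F facet_of \<sigma>" "F \<in> K" "u \<in> F"
          using not_rel_interior_imp_facet[OF K K'(1) u(1)] by blast
        then have "F \<in> L" "F \<noteq> \<sigma>" using L st(1) by (auto simp: face_closed_def facet_of_def)
        then have "F = \<tau>" using x u F st(5) by (auto simp: obstacle_def)
        have "u \<in> rel_interior \<tau>"
        proof (rule ccontr)
          assume "u \<notin> rel_interior \<tau>"
          then obtain G where G: "G facet_of \<tau>" "G \<in> K" "u \<in> G"
            using not_rel_interior_imp_facet[OF K K'(2)] F(3) \<open>F = \<tau>\<close> by blast
          then have "G \<in> skel2" using \<tau>(3) by (auto simp: skel2_def facet_of_def)
          then show False using x u G by (auto simp: obstacle_def)
        qed
        then show ?thesis using u by blast
      qed (use u in \<open>auto simp: N_def\<close>)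
    qed (use x in \<open>auto simp: U_def\<close>)
  qed
  then show ?thesis
    using that[of s'] flat_section_subset[OF s'(1)] s'(2) rs by (auto simp: U_def)
qed

lemma extend_elementary_collapse:
  assumes L: "face_closed L" and col: "elementary_collapse L L'" and D: "h ` \<Union>K - M \<subseteq> h ` \<Union>L'"
    and s: "flat_section M a (M - obstacle L) s"
  obtains s' where "flat_section M a (M - obstacle L') s'" "\<And>x. x \<in> M - obstacle L \<Longrightarrow> s' x = s x"
proof -
  obtain \<sigma> \<tau> where st: "\<sigma> \<in> L" "\<tau> \<in> L" "\<tau> facet_of \<sigma>" "\<forall>\<rho>\<in>L. \<tau> face_of \<rho> \<longrightarrow> \<rho> = \<tau> \<or> \<rho> = \<sigma>"
      "L' = L - {\<sigma>, \<tau>}"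
    using col unfolding elementary_collapse_def by blast
  have K': "\<sigma> \<in> K" "\<tau> \<in> K" using L st by (auto simp: face_closed_def)
  consider "aff_dim \<sigma> \<le> 2" | "aff_dim \<sigma> = 3" | "aff_dim \<sigma> = 4"
    using aff_dim_le_4[OF K'(1)] by linarith
  then show ?thesis
  proof cases
    case 1
    then have "\<sigma> \<in> skel2" "\<tau> \<in> skel2" using K' st(3) by (auto simp: skel2_def facet_of_def)
    then have "obstacle L' = obstacle L" using st(1,2,5) by (auto simp: obstacle_def)
    then show ?thesis using s that by auto
  next
    case 2
    show ?thesis
      using extend_dim_3[OF L st(1-3) _ st(5) 2 D s] st(4) that by blast
  next
    case 3
    show ?thesis
      using extend_dim_4[OF L st(1-3) _ st(5) 3 D s] st(4) that by blast
  qed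
qed

lemma extend_collapse:
  assumes "elementary_collapse\<^sup>*\<^sup>* K L" and "h ` \<Union>K - M \<subseteq> h ` \<Union>L"
    and s: "flat_section M a (M - obstacle K) s"
  shows "face_closed L \<and> (\<exists>s'. flat_section M a (M - obstacle L) s' \<and> (\<forall>x \<in> M - obstacle K. s' x = s x))"
  using assms(1,2)
proof (induction rule: rtranclp_induct)
  case base
  have "face_closed K" using simplicial_complexD(4)[OF K] by (auto simp: face_closed_def)
  then show ?case using s by blast
next
  case (step L L')
  \<comment> \<open>Complexes shrink, so the covering hypothesis on the later stage passes back to
    the earlier one.\<close>
  have "L' \<subseteq> L" using step(2) by (auto simp: elementary_collapse_def)
  then have "h ` \<Union>K - M \<subseteq> h ` \<Union>L" using step.prems by blast
  with step.IH obtain s1 where L: "face_closed L" and s1: "flat_section M a (M - obstacle L) s1"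
    "\<forall>x \<in> M - obstacle K. s1 x = s x" by blast
  obtain s' where s': "flat_section M a (M - obstacle L') s'" "\<And>x. x \<in> M - obstacle L \<Longrightarrow> s' x = s1 x"
    using extend_elementary_collapse[OF L step(2) step.prems s1(1)] by blast
  have "obstacle L \<subseteq> obstacle K" using L by (auto simp: obstacle_def face_closed_def)
  then have "\<forall>x \<in> M - obstacle K. s' x = s x"
    using s'(2) s1(2) by (metis Diff_iff subsetD)
  then show ?case using elementary_collapse_face_closed[OF L step(2)] s'(1) by blast
qed

lemma negligible_cone_skel2:
  "negligible {x + t *\<^sub>R (z - x) | t z. z \<in> h ` \<Union>skel2}"
proof -
  have "{x + t *\<^sub>R (z - x) | t z. z \<in> h ` \<Union>skel2} = (\<Union>\<rho>\<in>skel2. {x + t *\<^sub>R (z - x) | t z. z \<in> h ` \<rho>})"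
    by blast
  moreover have "finite skel2" using finite_K skel2_subset finite_subset by blast
  moreover have "negligible {x + t *\<^sub>R (z - x) | t z. z \<in> h ` \<rho>}" if "\<rho> \<in> skel2" for \<rho>
    using smooth[of \<rho>] that by (intro negligible_cone_smooth_image) (auto simp: skel2_def diffeomorphism_def)
  ultimately show ?thesis by (auto intro!: negligible_Union)
qed

lemma homotopic_into_complement:
  assumes col: "elementary_collapse\<^sup>*\<^sup>* K L" and D: "h ` \<Union>K - M \<subseteq> h ` \<Union>L"
    and dim: "\<And>\<sigma>. \<sigma> \<in> L \<Longrightarrow> aff_dim \<sigma> \<le> 2"
    and p: "path p" "path_image p \<subseteq> M" "pathstart p = a" "a \<notin> h ` \<Union>K" "pathfinish p \<notin> h ` \<Union>K"
  obtains q where "path q" "path_image q \<subseteq> M - h ` \<Union>K" "homotopic_paths M q p"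
proof -
  define O0 where "O0 = M - h ` \<Union>K"
  have "obstacle K = h ` \<Union>K" using skel2_subset by (auto simp: obstacle_def)
  then have O0: "O0 = M - obstacle K" "open O0" "O0 \<subseteq> M"
    using M closed_obstacle[of K] by (auto simp: O0_def)
  define s where "s = (\<lambda>x. {p. \<exists>q. path q \<and> path_image q \<subseteq> O0 \<and> pathstart q = a \<and> pathfinish q = x \<and> homotopic_paths M q p})"
  have "flat_section M a O0 s"
    unfolding s_def by (rule flat_section_homotopic_into[OF O0(2,3)])
  then obtain s1 where L: "face_closed L" and s1: "flat_section M a (M - obstacle L) s1" "\<forall>x \<in> O0. s1 x = s x"
    using extend_collapse[OF col D] O0(1) by metis
  \<comment> \<open>Every simplex left by the collapse has dimension at most 2, so exactly the
    2-skeleton is still removed.\<close>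
  have "obstacle L = h ` \<Union>skel2"
    using L dim by (auto simp: obstacle_def skel2_def face_closed_def)
  then obtain s2 where s2: "flat_section M a M s2" "\<And>x. x \<in> M - obstacle L \<Longrightarrow> s2 x = s1 x"
    using flat_section_extend_negligible_cones[OF s1(1) M] negligible_cone_skel2 by metis
  have eq: "s2 x = s x" if "x \<in> O0" for x
  proof -
    have "obstacle L \<subseteq> obstacle K" using L by (auto simp: obstacle_def face_closed_def)
    then have "x \<in> M - obstacle L" using that O0(1) by auto
    then show ?thesis using s2(2) s1(2) that by simp
  qed
  have ends: "a \<in> O0" "pathfinish p \<in> O0"
    using p pathstart_in_path_image[of p] pathfinish_in_path_image[of p] by (auto simp: O0_def)
  \<comment> \<open>The constant path is the seed: transporting it along \<open>p\<close> puts
    \<open>p\<close> into the value at the far end.\<close>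
  have "linepath a a \<in> s a"
    using ends(1) O0(3) unfolding s_def by (intro CollectI exI[of _ "linepath a a"]) auto
  moreover have "homotopic_paths M (linepath a a +++ p) p"
    using homotopic_paths_lid[OF p(1,2)] p(3) by simp
  ultimately have "p \<in> transport M (s a) p"
    by (auto simp: transport_def)
  then have "p \<in> s (pathfinish p)"
    using flat_section_along_path[OF s2(1) p(1,2)] eq ends p(3) by simp
  then show ?thesis using that by (auto simp: s_def O0_def)
qed

end

section \<open>Loops in the complement of a surface\<close>

lemma finite_closed_cover_has_interior:
  assumes "finite F" "\<And>C. C \<in> F \<Longrightarrow> closedin (top_of_set R) C"
    and "openin (top_of_set R) U" "U \<noteq> {}" "U \<subseteq> \<Union>F"
  shows "\<exists>C\<in>F. \<exists>V. openin (top_of_set R) V \<and> V \<noteq> {} \<and> V \<subseteq> C"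
  using assms
proof (induction F arbitrary: U rule: finite_induct)
  case (insert C F)
  show ?case
  proof (cases "U \<subseteq> C")
    case False
    \<comment> \<open>The part outside \<open>C\<close> is still relatively open and is covered by
      one set fewer.\<close>
    have "openin (top_of_set R) (U - C)"
      using insert.prems(1)[of C] insert.prems(2) by (intro openin_diff) auto
    moreover have "U - C \<noteq> {}" "U - C \<subseteq> \<Union>F" using False insert.prems(4) by auto
    ultimately show ?thesis
      using insert.IH[of "U - C"] insert.prems(1) by blast
  qed (use insert.prems in blast)
qed auto

text \<open>The complex left by the collapse and the one that witnesses the dimension of
  \<open>X\<close> are unrelated triangulations, so their dimensions are compared topologically. One
  of the finitely many closed pieces covering the relative interior has interior, and invariance of
  dimension applies there.\<close>

lemma aff_dim_le_of_embedding_into_complex: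
  fixes \<sigma> :: "'a::euclidean_space set" and \<phi> :: "'a \<Rightarrow> 'b::euclidean_space"
  assumes \<sigma>: "convex \<sigma>" "continuous_on \<sigma> \<phi>" "inj_on \<phi> \<sigma>" "\<phi> ` \<sigma> \<subseteq> \<Union>T"
    and T: "finite T" "\<And>\<rho>. \<rho> \<in> T \<Longrightarrow> closed \<rho>" "\<And>\<rho>. \<rho> \<in> T \<Longrightarrow> aff_dim \<rho> \<le> d" and d: "- 1 \<le> d"
  shows "aff_dim \<sigma> \<le> d"
proof (cases "\<sigma> = {}")
  case False
  let ?R = "rel_interior \<sigma>"
  have R: "?R \<noteq> {}" "?R \<subseteq> \<sigma>" using False \<sigma>(1) rel_interior_eq_empty rel_interior_subset by blast+
  have cont: "continuous_on ?R \<phi>" using \<sigma>(2) R(2) continuous_on_subset by blast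
  have "\<exists>C\<in>(\<lambda>\<rho>. ?R \<inter> \<phi> -` \<rho>) ` T. \<exists>V. openin (top_of_set ?R) V \<and> V \<noteq> {} \<and> V \<subseteq> C"
  proof (rule finite_closed_cover_has_interior[of _ ?R ?R])
    show "closedin (top_of_set ?R) C" if "C \<in> (\<lambda>\<rho>. ?R \<inter> \<phi> -` \<rho>) ` T" for C
      using that T(2) cont by (auto intro: continuous_closedin_preimage)
    show "?R \<subseteq> \<Union>((\<lambda>\<rho>. ?R \<inter> \<phi> -` \<rho>) ` T)" using \<sigma>(4) R(2) by blast
  qed (use R T(1) in auto)
  then obtain \<rho> V where V: "\<rho> \<in> T" "openin (top_of_set ?R) V" "V \<noteq> {}" "V \<subseteq> ?R \<inter> \<phi> -` \<rho>"
    by auto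
  have "aff_dim (affine hull \<sigma>) \<le> aff_dim (affine hull \<rho>)"
  proof (rule invariance_of_dimension_affine_sets[of _ V _ \<phi>])
    show "openin (top_of_set (affine hull \<sigma>)) V"
      using V(2) openin_rel_interior openin_trans by blast
    show "continuous_on V \<phi>" using cont V(4) continuous_on_subset by blast
    show "inj_on \<phi> V" using \<sigma>(3) V(4) R(2) inj_on_subset by blast
    show "\<phi> \<in> V \<rightarrow> affine hull \<rho>" using V(4) hull_subset[of \<rho> affine] by auto
  qed (use V in auto)
  then show ?thesis using T(3)[OF V(1)] by simp
qed (use d in simp)

section \<open>Fundamental groups and inclusions\<close>

lemma homotopy_class_eq:
  assumes "homotopic_paths Y g h"
  shows "homotopy_class Y g = homotopy_class Y h"
  using assms unfolding homotopy_class_def by (auto intro: homotopic_paths_trans homotopic_paths_sym)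

lemma loops_atD:
  assumes "g \<in> loops_at X a"
  shows "path g" "path_image g \<subseteq> X" "pathstart g = a" "pathfinish g = a" "homotopic_paths X g g"
  using assms by (auto simp: loops_at_def)

text \<open>The product in \<open>fundamental_group\<close> is a union over all representatives; it
  is a single class because they all yield the same one.\<close>

lemma mult_homotopy_class:
  assumes g: "g \<in> loops_at Y a" and h: "h \<in> loops_at Y a"
  shows "homotopy_class Y g \<otimes>\<^bsub>fundamental_group Y a\<^esub> homotopy_class Y h = homotopy_class Y (g +++ h)"
proof -
  have "homotopy_class Y (g' +++ h') = homotopy_class Y (g +++ h)"
    if "g' \<in> homotopy_class Y g" "h' \<in> homotopy_class Y h" for g' h'
    using that loops_atD[OF g] loops_atD[OF h] unfolding homotopy_class_def[of Y g] homotopy_class_def[of Y h]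
    by (intro homotopy_class_eq homotopic_paths_sym[OF homotopic_paths_join]) auto
  moreover have "g \<in> homotopy_class Y g" "h \<in> homotopy_class Y h"
    using loops_atD[OF g] loops_atD[OF h] by (auto simp: homotopy_class_def)
  ultimately have "(\<Union>g'\<in>homotopy_class Y g. \<Union>h'\<in>homotopy_class Y h. homotopy_class Y (g' +++ h')) =
      homotopy_class Y (g +++ h)"
    by (intro SUP_eq_const) blast+
  then show ?thesis by (simp add: fundamental_group_def)
qed

lemma induced_map_inclusion:
  assumes g: "g \<in> loops_at X a" and "X \<subseteq> Y"
  shows "induced_map Y id (homotopy_class X g) = homotopy_class Y g"
proof -
  have "homotopy_class Y h = homotopy_class Y g" if "h \<in> homotopy_class X g" for h
    using that homotopic_paths_subset[OF _ assms(2), of g h] homotopy_class_eq[of Y g h]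
    by (simp add: homotopy_class_def)
  moreover have "g \<in> homotopy_class X g"
    using loops_atD[OF g] by (auto simp: homotopy_class_def)
  ultimately show ?thesis
    unfolding induced_map_def id_comp by (intro SUP_eq_const) blast+
qed

lemma induced_map_inclusion_epi:
  assumes XY: "X \<subseteq> Y" and loops: "\<And>g. g \<in> loops_at Y a \<Longrightarrow> \<exists>h\<in>loops_at X a. homotopic_paths Y h g"
  shows "induced_map Y id \<in> epi (fundamental_group X a) (fundamental_group Y a)"
  unfolding epi_iff_subset hom_def
proof (intro conjI CollectI ballI funcsetI subsetI)
  have lift: "g \<in> loops_at Y a" if "g \<in> loops_at X a" for g
    using that XY by (auto simp: loops_at_def)
  note ind = induced_map_inclusion[OF _ XY]
  fix A assume "A \<in> carrier (fundamental_group X a)"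
  then obtain g where g: "g \<in> loops_at X a" "A = homotopy_class X g"
    by (auto simp: fundamental_group_def)
  then show "induced_map Y id A \<in> carrier (fundamental_group Y a)"
    using ind lift by (auto simp: fundamental_group_def)
  fix B assume "B \<in> carrier (fundamental_group X a)"
  then obtain h where h: "h \<in> loops_at X a" "B = homotopy_class X h"
    by (auto simp: fundamental_group_def)
  have "g +++ h \<in> loops_at X a"
    using loops_atD[OF g(1)] loops_atD[OF h(1)] by (simp add: loops_at_def path_image_join)
  then show "induced_map Y id (A \<otimes>\<^bsub>fundamental_group X a\<^esub> B) =
      induced_map Y id A \<otimes>\<^bsub>fundamental_group Y a\<^esub> induced_map Y id B"
    using g h ind lift mult_homotopy_class by metis
next
  fix C assume "C \<in> carrier (fundamental_group Y a)"
  then obtain g where g: "g \<in> loops_at Y a" "C = homotopy_class Y g"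
    by (auto simp: fundamental_group_def)
  then obtain h where h: "h \<in> loops_at X a" "homotopic_paths Y h g" using loops by blast
  then have "C = induced_map Y id (homotopy_class X h)"
    using induced_map_inclusion[OF h(1) XY] homotopy_class_eq[OF h(2)] g(2) by simp
  then show "C \<in> induced_map Y id ` carrier (fundamental_group X a)"
    using h(1) by (auto simp: fundamental_group_def)
qed

text \<open>The loop is prolonged by the segment between \<open>a\<close> and
  \<open>2 *\<^sub>R a\<close>, so that it starts and ends outside the ball. Once it is deformed off
  the ball inside \<open>M\<close>, the radial retraction carries the new loop into
  \<open>S3 - S\<close> and the deformation into \<open>D4 - S\<close>.\<close>

lemma loop_homotopic_into_sphere:
  fixes S X :: "(real^4) set"
  assumes S: "closed S" "S \<subseteq> X" and X: "compact_polyhedron_2d X" "collapses_onto D4 X"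
    and a: "a \<in> S3 - S" and \<gamma>: "\<gamma> \<in> loops_at (D4 - S) a"
  shows "\<exists>q\<in>loops_at (S3 - S) a. homotopic_paths (D4 - S) q \<gamma>"
proof -
  obtain K L h where KL: "smooth_triangulation K h D4" "elementary_collapse\<^sup>*\<^sup>* K L" "h ` \<Union>L = X"
    using X(2) unfolding collapses_onto_def by blast
  then obtain g where K: "simplicial_complex K" and hom: "homeomorphism (\<Union>K) D4 h g"
    and smooth: "\<forall>\<sigma>\<in>K. diffeomorphism \<sigma> (h ` \<sigma>) h g"
    unfolding smooth_triangulation_def by blast
  have hK: "h ` \<Union>K = D4" using hom by (simp add: homeomorphism_def)
  have "L \<subseteq> K"
    using KL(2) by (induction rule: rtranclp_induct) (auto simp: elementary_collapse_def)
  have dim: "aff_dim \<sigma> \<le> 2" if \<sigma>: "\<sigma> \<in> L" for \<sigma>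
  proof -
    obtain T :: "(real^5) set set" where T: "simplicial_complex T" "\<forall>\<rho>\<in>T. aff_dim \<rho> \<le> 2" "\<Union>T homeomorphic X"
      using X(1) unfolding compact_polyhedron_2d_def by blast
    obtain k k' where k: "homeomorphism X (\<Union>T) k k'"
      using T(3) homeomorphic_sym unfolding homeomorphic_def by metis
    have \<sigma>K: "\<sigma> \<in> K" "\<sigma> \<subseteq> \<Union>K" "h ` \<sigma> \<subseteq> X" using \<sigma> \<open>L \<subseteq> K\<close> KL(3) by auto
    have cont: "continuous_on \<sigma> h" using hom \<sigma>K(2) continuous_on_subset by (auto simp: homeomorphism_def)
    show ?thesis
    proof (rule aff_dim_le_of_embedding_into_complex[of \<sigma> "k \<circ> h" T])
      show "continuous_on \<sigma> (k \<circ> h)"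
        using k \<sigma>K(3) continuous_on_subset cont by (intro continuous_on_compose) (auto simp: homeomorphism_def)
      show "inj_on (k \<circ> h) \<sigma>"
      proof (rule comp_inj_on)
        show "inj_on h \<sigma>" using homeomorphism_apply1[OF hom] \<sigma>K(2) by (metis inj_onI subsetD)
        show "inj_on k (h ` \<sigma>)" using homeomorphism_apply1[OF k] \<sigma>K(3) by (metis inj_onI subsetD)
      qed
      show "(k \<circ> h) ` \<sigma> \<subseteq> \<Union>T"
        using homeomorphism_image1[OF k] \<sigma>K(3) by (metis image_comp image_mono)
      show "convex \<sigma>" using simplicial_complexD(1)[OF K \<sigma>K(1)] .
      show "finite T" using T(1) by (auto simp: simplicial_complex_def)
      show "closed \<rho>" if "\<rho> \<in> T" for \<rho> using simplicial_complexD(2)[OF T(1) that] compact_imp_closed by blast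
    qed (use T(2) in auto)
  qed
  \<comment> \<open>Dividing by the maximum fixes the ball pointwise, moves the outside radially to
    the sphere, and stays continuous at the origin.\<close>
  define r :: "real^4 \<Rightarrow> real^4" where "r x = x /\<^sub>R max 1 (norm x)" for x
  have r_in: "r x = x" if "norm x \<le> 1" for x using that by (simp add: r_def)
  have r_out: "norm (r x) = 1" if "norm x \<ge> 1" for x
  proof -
    have "x \<noteq> 0" using that by auto
    then show ?thesis using that by (simp add: r_def)
  qed
  have r_D4: "r x \<in> D4" for x using r_in[of x] r_out[of x] by (cases "norm x \<le> 1") auto
  have cont_r: "continuous_on A r" for A
    unfolding r_def by (intro continuous_intros) auto
  \<comment> \<open>The removed set is \<open>S\<close> together with the outward rays from its
    points on the sphere.\<close>
  define M where "M = - (r -` S)"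
  have M: "open M"
    using S(1) cont_r[of UNIV] unfolding M_def by (intro open_Compl closed_vimage)
  have na: "norm a = 1" "a \<notin> S" using a by auto
  \<comment> \<open>The retraction crushes the added segment to \<open>a\<close>, so up to constant
    paths it takes the prolonged loop back to the original one.\<close>
  have r_seg: "r x = a" if x: "x \<in> closed_segment a (2 *\<^sub>R a)" for x
  proof -
    obtain u where u: "0 \<le> u" "x = (1 - u) *\<^sub>R a + u *\<^sub>R (2 *\<^sub>R a)"
      using x by (auto simp: in_segment)
    then have "x = ((1 - u) + u * 2) *\<^sub>R a" by (simp only: scaleR_scaleR scaleR_add_left)
    then have "x = (1 + u) *\<^sub>R a" by simp
    moreover from this have "norm x = 1 + u" using u(1) na by simp
    ultimately show ?thesis using u(1) by (simp add: r_def)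
  qed
  interpret smooth_complex K h g M "2 *\<^sub>R a"
    using K hom hK smooth M by unfold_locales auto
  note \<gamma> = loops_atD[OF \<gamma>]
  let ?l1 = "linepath (2 *\<^sub>R a) a" and ?l2 = "linepath a (2 *\<^sub>R a)"
  define p where "p = ?l1 +++ (\<gamma> +++ ?l2)"
  have "path p" "pathstart p = 2 *\<^sub>R a" "pathfinish p = 2 *\<^sub>R a"
    using \<gamma> by (auto simp: p_def)
  moreover have "path_image p \<subseteq> M"
  proof -
    have "closed_segment a (2 *\<^sub>R a) \<subseteq> M" using r_seg na by (auto simp: M_def)
    moreover have "path_image \<gamma> \<subseteq> M" using \<gamma>(2) r_in by (auto simp: M_def)
    ultimately show ?thesis
      using \<gamma> by (simp add: p_def path_image_join closed_segment_commute)
  qed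
  moreover have "2 *\<^sub>R a \<notin> h ` \<Union>K" using na by (simp add: hK)
  \<comment> \<open>The retraction is the identity on the ball, so the only points of the ball
    missing from \<open>M\<close> are those of \<open>S\<close>, and these lie in
    \<open>X\<close>.\<close>
  moreover have "h ` \<Union>K - M \<subseteq> h ` \<Union>L"
    using S(2) r_in unfolding hK KL(3) M_def by auto
  ultimately obtain q where q: "path q" "path_image q \<subseteq> M - D4" "homotopic_paths M q p"
    using homotopic_into_complement[OF KL(2) _ dim, of p] by (metis hK)
  have rM: "r \<in> M \<rightarrow> D4 - S" using r_D4 by (auto simp: M_def)
  have "homotopic_paths (D4 - S) (r \<circ> q) (r \<circ> p)"
    by (rule homotopic_paths_continuous_image[OF q(3) cont_r rM])
  also have "homotopic_paths (D4 - S) (r \<circ> p) \<gamma>"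
  proof -
    have aD: "a \<in> D4 - S" using na by auto
    have l: "homotopic_paths (D4 - S) (linepath a a) (r \<circ> ?l1)" "homotopic_paths (D4 - S) (linepath a a) (r \<circ> ?l2)"
    proof -
      have "?l1 t \<in> closed_segment a (2 *\<^sub>R a)" "?l2 t \<in> closed_segment a (2 *\<^sub>R a)" if "t \<in> {0..1}" for t
        using that linepath_in_path[of t "2 *\<^sub>R a" a] linepath_in_path[of t a "2 *\<^sub>R a"]
        by (auto simp: closed_segment_commute)
      then show "homotopic_paths (D4 - S) (linepath a a) (r \<circ> ?l1)" "homotopic_paths (D4 - S) (linepath a a) (r \<circ> ?l2)"
        using aD r_seg by (auto intro!: homotopic_paths_eq simp: linepath_refl path_def)
    qed
    have rg: "homotopic_paths (D4 - S) \<gamma> (r \<circ> \<gamma>)"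
    proof (rule homotopic_paths_eq[OF \<gamma>(1,2)])
      fix t :: real assume "t \<in> {0..1}"
      then have "\<gamma> t \<in> D4" using \<gamma>(2) unfolding path_image_def by blast
      then show "\<gamma> t = (r \<circ> \<gamma>) t" using r_in by simp
    qed
    have lid: "homotopic_paths (D4 - S) (linepath a a +++ \<gamma>) \<gamma>"
      and rid: "homotopic_paths (D4 - S) (\<gamma> +++ linepath a a) \<gamma>"
      using homotopic_paths_lid[OF \<gamma>(1,2)] homotopic_paths_rid[OF \<gamma>(1,2)] \<gamma>(3,4) by simp_all
    have "homotopic_paths (D4 - S) (\<gamma> +++ linepath a a) (r \<circ> (\<gamma> +++ ?l2))"
      unfolding path_compose_join using rg l(2) \<gamma>(4) by (intro homotopic_paths_join) auto
    then have "homotopic_paths (D4 - S) \<gamma> (r \<circ> (\<gamma> +++ ?l2))"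
      by (rule homotopic_paths_trans[OF homotopic_paths_sym[OF rid]])
    then have "homotopic_paths (D4 - S) (linepath a a +++ \<gamma>) ((r \<circ> ?l1) +++ (r \<circ> (\<gamma> +++ ?l2)))"
      using l(1) \<gamma>(3) by (intro homotopic_paths_join) auto
    then have "homotopic_paths (D4 - S) (linepath a a +++ \<gamma>) (r \<circ> p)"
      by (simp only: p_def path_compose_join)
    then show ?thesis
      by (rule homotopic_paths_trans[OF homotopic_paths_sym lid])
  qed
  finally have hq: "homotopic_paths (D4 - S) (r \<circ> q) \<gamma>" .
  have "r x \<in> S3 - S" if "x \<in> M - D4" for x
    using that r_out[of x] by (simp add: M_def)
  then have "path_image (r \<circ> q) \<subseteq> S3 - S"
    using q(2) unfolding path_image_compose by blast
  moreover have "path (r \<circ> q)" using q(1) cont_r by (intro path_continuous_image)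
  ultimately have "r \<circ> q \<in> loops_at (S3 - S) a"
    using homotopic_paths_imp_pathstart[OF hq] homotopic_paths_imp_pathfinish[OF hq] \<gamma>(3,4)
    by (simp add: loops_at_def)
  then show ?thesis using hq by blast
qed

theorem proposition2p6:
  fixes S X :: "(real^4) set"
  assumes "properly_embedded_surface S"
    and "shadow X"
    and "S \<subseteq> X"
  shows "homotopically_ribbon S"
proof -
  have S: "closed S" "surface_boundary S = S \<inter> S3"
    using assms(1) by (auto simp: properly_embedded_surface_def surface_def compact_imp_closed)
  have X: "compact_polyhedron_2d X" "collapses_onto D4 X"
    using assms(2) by (auto simp: shadow_def simple_polyhedron_def)
  have eq: "S3 - surface_boundary S = S3 - S" using S(2) by auto
  have "induced_map (D4 - S) id
      \<in> epi (fundamental_group (S3 - S) a) (fundamental_group (D4 - S) a)" if a: "a \<in> S3 - S" for a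
    using loop_homotopic_into_sphere[OF S(1) assms(3) X a]
    by (intro induced_map_inclusion_epi) auto
  then show ?thesis
    using assms(1) unfolding homotopically_ribbon_def eq by blast
qed

end
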